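(* The category $\mathsf{Pro}(\mathsf{Set}_{\mathbf{L}}^\omega)$ is categorically equivalent to $\mathsf{Stone}_{\mathbf{L}}$.
   Context: Setting: $\mathbf{L}$ is a finite algebra with an underlying bounded lattice $(L,\wedge,\vee,0,1)$, $0\neq 1$ (the lattice operations and the bounds belong to the signature of $\mathbf{L}$, so every subalgebra contains $0,1$), and $\mathbf{L}$ is semi-primal: for every $n\ge 1$, every function $f\colon L^n\to L$ that preserves subalgebras (meaning $f(a_1,\dots,a_n)$ always lies in the subalgebra generated by $a_1,\dots,a_n$) is term-definable in $\mathbf{L}$. $\mathbb{S}(\mathbf{L})$ is the finite lattice of subalgebras of $\mathbf{L}$ ordered by inclusion. The category $\mathsf{Stone}_{\mathbf{L}}$ has as objects pairs $(X,\mathbf{v})$ with $X$ a Stone space (compact, Hausdorff, zero-dimensional) and $\mathbf{v}\colon X\to\mathbb{S}(\mathbf{L})$ a map such that $\mathbf{v}^{-1}(\{\mathbf{S}'\mid\mathbf{S}'\le\mathbf{S}\})$ is closed for every $\mathbf{S}\le\mathbf{L}$; morphisms $(X,\mathbf{v})\to(Y,\mathbf{w})$ are continuous maps $m\colon X\to Y$ with $\mathbf{w}(m(x))\le\mathbf{v}(x)$ for all $x\in X$. $\mathsf{Set}_{\mathbf{L}}^\omega$ denotes the full subcategory of $\mathsf{Stone}_{\mathbf{L}}$ of those $(X,\mathbf{v})$ with $X$ finite (hence discrete). $\mathsf{Pro}(\mathsf{C})$ denotes the (free) completion of a category $\mathsf{C}$ under cofiltered limits. *)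

theory Defs
  imports "HOL-Analysis.Analysis"
begin

unbundle cardinal_syntax

section \<open>Algebras and semi-primality\<close>

text \<open>
  An algebra with universe the type \<^typ>\<open>'a\<close> whose operation symbols are the elements of the
  type \<^typ>\<open>'f\<close>.  Only the values of \<open>interp L f\<close> on lists of length \<open>arity L f\<close> are meaningful.
\<close>

record ('f, 'a) algebra =
  arity :: "'f \<Rightarrow> nat"
  interp :: "'f \<Rightarrow> 'a list \<Rightarrow> 'a"

definition lattice_based :: "('f, 'a::bounded_lattice) algebra \<Rightarrow> bool" where
  "lattice_based L \<longleftrightarrow>
     (\<exists>m. arity L m = 2 \<and> (\<forall>x y. interp L m [x, y] = inf x y)) \<and>
     (\<exists>j. arity L j = 2 \<and> (\<forall>x y. interp L j [x, y] = sup x y)) \<and>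
     (\<exists>z. arity L z = 0 \<and> interp L z [] = bot) \<and>
     (\<exists>e. arity L e = 0 \<and> interp L e [] = top)"

definition subalgebra :: "('f, 'a) algebra \<Rightarrow> 'a set \<Rightarrow> bool" where
  "subalgebra L S \<longleftrightarrow>
     (\<forall>f xs. length xs = arity L f \<and> set xs \<subseteq> S \<longrightarrow> interp L f xs \<in> S)"

definition generated_subalgebra :: "('f, 'a) algebra \<Rightarrow> 'a set \<Rightarrow> 'a set" where
  "generated_subalgebra L A = \<Inter>{S. subalgebra L S \<and> A \<subseteq> S}"

datatype 'f alg_term = Var nat | App 'f "'f alg_term list"

primrec wf_term :: "('f, 'a) algebra \<Rightarrow> nat \<Rightarrow> 'f alg_term \<Rightarrow> bool" where
  "wf_term L n (Var i) \<longleftrightarrow> i < n"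
| "wf_term L n (App f ts) \<longleftrightarrow> length ts = arity L f \<and> list_all (wf_term L n) ts"

primrec eval_term :: "('f, 'a) algebra \<Rightarrow> 'a list \<Rightarrow> 'f alg_term \<Rightarrow> 'a" where
  "eval_term L xs (Var i) = xs ! i"
| "eval_term L xs (App f ts) = interp L f (map (eval_term L xs) ts)"

text \<open>An \<open>n\<close>-ary function is represented by its values on lists of length \<open>n\<close>.\<close>

definition preserves_subalgebras :: "('f, 'a) algebra \<Rightarrow> nat \<Rightarrow> ('a list \<Rightarrow> 'a) \<Rightarrow> bool" where
  "preserves_subalgebras L n g \<longleftrightarrow>
     (\<forall>xs. length xs = n \<longrightarrow> g xs \<in> generated_subalgebra L (set xs))"

definition term_definable :: "('f, 'a) algebra \<Rightarrow> nat \<Rightarrow> ('a list \<Rightarrow> 'a) \<Rightarrow> bool" where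
  "term_definable L n g \<longleftrightarrow>
     (\<exists>t. wf_term L n t \<and> (\<forall>xs. length xs = n \<longrightarrow> eval_term L xs t = g xs))"

definition semi_primal :: "('f, 'a) algebra \<Rightarrow> bool" where
  "semi_primal L \<longleftrightarrow>
     (\<forall>n\<ge>1. \<forall>g. preserves_subalgebras L n g \<longrightarrow> term_definable L n g)"


section \<open>Categories, functors, equivalences\<close>

text \<open>
  Hom-sets of different pairs of objects may overlap, so composition takes the three objects as
  arguments: \<open>Comp C a b c g f\<close> is the composite of \<open>f : a \<rightarrow> b\<close> and \<open>g : b \<rightarrow> c\<close>.
\<close>

record ('o, 'm) category =
  Obj :: "'o set"
  Hom :: "'o \<Rightarrow> 'o \<Rightarrow> 'm set"
  Id :: "'o \<Rightarrow> 'm"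
  Comp :: "'o \<Rightarrow> 'o \<Rightarrow> 'o \<Rightarrow> 'm \<Rightarrow> 'm \<Rightarrow> 'm"

definition is_category :: "('o, 'm) category \<Rightarrow> bool" where
  "is_category C \<longleftrightarrow>
     (\<forall>a\<in>Obj C. Id C a \<in> Hom C a a) \<and>
     (\<forall>a\<in>Obj C. \<forall>b\<in>Obj C. \<forall>c\<in>Obj C. \<forall>f\<in>Hom C a b. \<forall>g\<in>Hom C b c.
        Comp C a b c g f \<in> Hom C a c) \<and>
     (\<forall>a\<in>Obj C. \<forall>b\<in>Obj C. \<forall>f\<in>Hom C a b.
        Comp C a a b f (Id C a) = f \<and> Comp C a b b (Id C b) f = f) \<and>
     (\<forall>a\<in>Obj C. \<forall>b\<in>Obj C. \<forall>c\<in>Obj C. \<forall>d\<in>Obj C.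
        \<forall>f\<in>Hom C a b. \<forall>g\<in>Hom C b c. \<forall>h\<in>Hom C c d.
        Comp C a c d h (Comp C a b c g f) = Comp C a b d (Comp C b c d h g) f)"

definition full_subcategory :: "('o, 'm) category \<Rightarrow> ('o \<Rightarrow> bool) \<Rightarrow> ('o, 'm) category" where
  "full_subcategory C P = C\<lparr>Obj := {a \<in> Obj C. P a}\<rparr>"

record ('o, 'm, 'p, 'n) cfunctor =
  Fobj :: "'o \<Rightarrow> 'p"
  Farr :: "'o \<Rightarrow> 'o \<Rightarrow> 'm \<Rightarrow> 'n"

definition is_functor ::
  "('o, 'm) category \<Rightarrow> ('p, 'n) category \<Rightarrow> ('o, 'm, 'p, 'n) cfunctor \<Rightarrow> bool" where
  "is_functor C D F \<longleftrightarrow>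
     is_category C \<and> is_category D \<and>
     (\<forall>a\<in>Obj C. Fobj F a \<in> Obj D) \<and>
     (\<forall>a\<in>Obj C. \<forall>b\<in>Obj C. \<forall>f\<in>Hom C a b. Farr F a b f \<in> Hom D (Fobj F a) (Fobj F b)) \<and>
     (\<forall>a\<in>Obj C. Farr F a a (Id C a) = Id D (Fobj F a)) \<and>
     (\<forall>a\<in>Obj C. \<forall>b\<in>Obj C. \<forall>c\<in>Obj C. \<forall>f\<in>Hom C a b. \<forall>g\<in>Hom C b c.
        Farr F a c (Comp C a b c g f) =
        Comp D (Fobj F a) (Fobj F b) (Fobj F c) (Farr F b c g) (Farr F a b f))"

definition id_functor :: "('o, 'm, 'o, 'm) cfunctor" where
  "id_functor = \<lparr>Fobj = (\<lambda>a. a), Farr = (\<lambda>a b f. f)\<rparr>"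

definition comp_functor ::
  "('p, 'n, 'q, 'k) cfunctor \<Rightarrow> ('o, 'm, 'p, 'n) cfunctor \<Rightarrow> ('o, 'm, 'q, 'k) cfunctor" where
  "comp_functor G F =
     \<lparr>Fobj = (\<lambda>a. Fobj G (Fobj F a)),
      Farr = (\<lambda>a b f. Farr G (Fobj F a) (Fobj F b) (Farr F a b f))\<rparr>"

definition is_iso :: "('o, 'm) category \<Rightarrow> 'o \<Rightarrow> 'o \<Rightarrow> 'm \<Rightarrow> bool" where
  "is_iso C a b f \<longleftrightarrow>
     f \<in> Hom C a b \<and>
     (\<exists>g\<in>Hom C b a. Comp C a b a g f = Id C a \<and> Comp C b a b f g = Id C b)"

definition is_natural_iso ::
  "('o, 'm) category \<Rightarrow> ('p, 'n) category \<Rightarrow> ('o, 'm, 'p, 'n) cfunctor \<Rightarrow>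
   ('o, 'm, 'p, 'n) cfunctor \<Rightarrow> ('o \<Rightarrow> 'n) \<Rightarrow> bool" where
  "is_natural_iso C D F G \<eta> \<longleftrightarrow>
     (\<forall>a\<in>Obj C. is_iso D (Fobj F a) (Fobj G a) (\<eta> a)) \<and>
     (\<forall>a\<in>Obj C. \<forall>b\<in>Obj C. \<forall>f\<in>Hom C a b.
        Comp D (Fobj F a) (Fobj F b) (Fobj G b) (\<eta> b) (Farr F a b f) =
        Comp D (Fobj F a) (Fobj G a) (Fobj G b) (Farr G a b f) (\<eta> a))"

definition equivalent_categories :: "('o, 'm) category \<Rightarrow> ('p, 'n) category \<Rightarrow> bool" where
  "equivalent_categories C D \<longleftrightarrow>
     (\<exists>F G \<eta> \<epsilon>. is_functor C D F \<and> is_functor D C G \<and>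
        is_natural_iso C C id_functor (comp_functor G F) \<eta> \<and>
        is_natural_iso D D (comp_functor F G) id_functor \<epsilon>)"


section \<open>The pro-completion\<close>

definition cofiltered :: "('o, 'm) category \<Rightarrow> bool" where
  "cofiltered J \<longleftrightarrow>
     Obj J \<noteq> {} \<and>
     (\<forall>a\<in>Obj J. \<forall>b\<in>Obj J. \<exists>c\<in>Obj J. Hom J c a \<noteq> {} \<and> Hom J c b \<noteq> {}) \<and>
     (\<forall>a\<in>Obj J. \<forall>b\<in>Obj J. \<forall>f\<in>Hom J a b. \<forall>g\<in>Hom J a b.
        \<exists>c\<in>Obj J. \<exists>h\<in>Hom J c a. Comp J c a b f h = Comp J c a b g h)"

text \<open>
  ``Small'' is relative to a cardinal \<open>\<kappa>\<close>: fewer than \<open>\<kappa>\<close> arrows (hence fewer than \<open>\<kappa>\<close> objects).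
\<close>

definition small_category :: "'k rel \<Rightarrow> ('o, 'm) category \<Rightarrow> bool" where
  "small_category \<kappa> J \<longleftrightarrow>
     |{(a, b, f). a \<in> Obj J \<and> b \<in> Obj J \<and> f \<in> Hom J a b}| <o \<kappa>"

text \<open>
  A pro-object of \<open>C\<close> is a formal limit of a diagram \<open>D : J \<rightarrow> C\<close> with \<open>J\<close> small and cofiltered.
  Its arrows are given by
  \<open>Hom (D : J \<rightarrow> C) (E : K \<rightarrow> C) = lim\<^sub>k colim\<^sub>j Hom C (D j) (E k)\<close>.
\<close>

record ('i, 'o, 'm) pro_object =
  index :: "('i, 'i) category"
  diagram :: "('i, 'i, 'o, 'm) cfunctor"

definition is_pro_object ::
  "'i rel \<Rightarrow> ('o, 'm) category \<Rightarrow> ('i, 'o, 'm) pro_object \<Rightarrow> bool" where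
  "is_pro_object \<kappa> C P \<longleftrightarrow>
     is_functor (index P) C (diagram P) \<and> cofiltered (index P) \<and> small_category \<kappa> (index P)"

abbreviation pro_ob :: "('i, 'o, 'm) pro_object \<Rightarrow> 'i \<Rightarrow> 'o" where
  "pro_ob P \<equiv> Fobj (diagram P)"

abbreviation pro_arr :: "('i, 'o, 'm) pro_object \<Rightarrow> 'i \<Rightarrow> 'i \<Rightarrow> 'i \<Rightarrow> 'm" where
  "pro_arr P \<equiv> Farr (diagram P)"

text \<open>
  \<open>colim\<^sub>j Hom C (P j) c\<close> is the quotient of the set \<open>germs C P c\<close> of all pairs \<open>(j, f)\<close>
  with \<open>f : P j \<rightarrow> c\<close> by the relation \<open>germ_rel C P c\<close>, which identifies \<open>(j, f)\<close> and \<open>(j', f')\<close>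
  iff they agree after restriction to a common \<open>k\<close>.
\<close>

definition germs ::
  "('o, 'm) category \<Rightarrow> ('i, 'o, 'm) pro_object \<Rightarrow> 'o \<Rightarrow> ('i \<times> 'm) set" where
  "germs C P c = {(j, f). j \<in> Obj (index P) \<and> f \<in> Hom C (pro_ob P j) c}"

definition germ_rel ::
  "('o, 'm) category \<Rightarrow> ('i, 'o, 'm) pro_object \<Rightarrow> 'o \<Rightarrow> ('i \<times> 'm) rel" where
  "germ_rel C P c =
     {((j, f), (j', f')). (j, f) \<in> germs C P c \<and> (j', f') \<in> germs C P c \<and>
        (\<exists>k\<in>Obj (index P). \<exists>u\<in>Hom (index P) k j. \<exists>u'\<in>Hom (index P) k j'.
           Comp C (pro_ob P k) (pro_ob P j) c f (pro_arr P k j u) =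
           Comp C (pro_ob P k) (pro_ob P j') c f' (pro_arr P k j' u'))}"

text \<open>The map \<open>colim\<^sub>j Hom C (P j) c \<rightarrow> colim\<^sub>j Hom C (P j) c'\<close> induced by \<open>g : c \<rightarrow> c'\<close>.\<close>

definition push_germ ::
  "('o, 'm) category \<Rightarrow> ('i, 'o, 'm) pro_object \<Rightarrow> 'o \<Rightarrow> 'o \<Rightarrow> 'm \<Rightarrow> ('i \<times> 'm) set \<Rightarrow> ('i \<times> 'm) set"
  where
  "push_germ C P c c' g \<gamma> =
     (\<Union>(j, f)\<in>\<gamma>. germ_rel C P c' `` {(j, Comp C (pro_ob P j) c c' g f)})"

definition pro_hom ::
  "('o, 'm) category \<Rightarrow> ('i, 'o, 'm) pro_object \<Rightarrow> ('i, 'o, 'm) pro_object \<Rightarrow>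
   ('i \<Rightarrow> ('i \<times> 'm) set) set" where
  "pro_hom C P Q =
     {\<phi> \<in> (\<Pi>\<^sub>E k\<in>Obj (index Q). germs C P (pro_ob Q k) // germ_rel C P (pro_ob Q k)).
        \<forall>k\<in>Obj (index Q). \<forall>k'\<in>Obj (index Q). \<forall>h\<in>Hom (index Q) k k'.
          push_germ C P (pro_ob Q k) (pro_ob Q k') (pro_arr Q k k' h) (\<phi> k) = \<phi> k'}"

definition pro_id ::
  "('o, 'm) category \<Rightarrow> ('i, 'o, 'm) pro_object \<Rightarrow> 'i \<Rightarrow> ('i \<times> 'm) set" where
  "pro_id C P =
     (\<lambda>k\<in>Obj (index P). germ_rel C P (pro_ob P k) `` {(k, Id C (pro_ob P k))})"

definition pro_comp ::
  "('o, 'm) category \<Rightarrow> ('i, 'o, 'm) pro_object \<Rightarrow> ('i, 'o, 'm) pro_object \<Rightarrow>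
   ('i, 'o, 'm) pro_object \<Rightarrow> ('i \<Rightarrow> ('i \<times> 'm) set) \<Rightarrow> ('i \<Rightarrow> ('i \<times> 'm) set) \<Rightarrow>
   'i \<Rightarrow> ('i \<times> 'm) set" where
  "pro_comp C P Q R \<psi> \<phi> =
     (\<lambda>l\<in>Obj (index R).
        \<Union>(k, g)\<in>\<psi> l. push_germ C P (pro_ob Q k) (pro_ob R l) g (\<phi> k))"

text \<open>
  The completion of \<open>C\<close> under limits of cofiltered diagrams with fewer than \<open>\<kappa>\<close> arrows.  As
  \<open>\<kappa>\<close> is a cardinal on (a subset of) the type \<^typ>\<open>'i\<close>, every index category with fewer than
  \<open>\<kappa>\<close> arrows is isomorphic to one with objects and arrows in \<^typ>\<open>'i\<close>.
\<close>

definition Pro ::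
  "'i rel \<Rightarrow> ('o, 'm) category \<Rightarrow> (('i, 'o, 'm) pro_object, 'i \<Rightarrow> ('i \<times> 'm) set) category" where
  "Pro \<kappa> C =
     \<lparr>Obj = {P. is_pro_object \<kappa> C P},
      Hom = pro_hom C,
      Id = pro_id C,
      Comp = pro_comp C\<rparr>"


section \<open>Stone spaces over an algebra\<close>

definition stone_space :: "'p topology \<Rightarrow> bool" where
  "stone_space X \<longleftrightarrow>
     compact_space X \<and> Hausdorff_space X \<and>
     neighbourhood_base_of (\<lambda>U. closedin X U \<and> openin X U) X"

definition is_stone_object :: "('f, 'a) algebra \<Rightarrow> 'p topology \<times> ('p \<Rightarrow> 'a set) \<Rightarrow> bool" where
  "is_stone_object L = (\<lambda>(X, v).
     stone_space X \<and> v \<in> topspace X \<rightarrow>\<^sub>E {S. subalgebra L S} \<and>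
     (\<forall>S. subalgebra L S \<longrightarrow> closedin X {x \<in> topspace X. v x \<subseteq> S}))"

definition Stone_cat ::
  "('f, 'a) algebra \<Rightarrow> ('p topology \<times> ('p \<Rightarrow> 'a set), 'p \<Rightarrow> 'p) category" where
  "Stone_cat L =
     \<lparr>Obj = {A. is_stone_object L A},
      Hom = (\<lambda>(X, v) (Y, w).
        {m \<in> topspace X \<rightarrow>\<^sub>E topspace Y.
           continuous_map X Y m \<and> (\<forall>x\<in>topspace X. w (m x) \<subseteq> v x)}),
      Id = (\<lambda>(X, v). \<lambda>x\<in>topspace X. x),
      Comp = (\<lambda>(X, v) _ _ g f. compose (topspace X) g f)\<rparr>"

definition FinSet_cat ::
  "('f, 'a) algebra \<Rightarrow> ('p topology \<times> ('p \<Rightarrow> 'a set), 'p \<Rightarrow> 'p) category" where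
  "FinSet_cat L = full_subcategory (Stone_cat L) (\<lambda>(X, v). finite (topspace X))"

text \<open>
  Smallness of a Stone space relative to a cardinal \<open>\<kappa>\<close>: the topology has a base with fewer than
  \<open>\<kappa>\<close> members.  If \<open>\<kappa>\<close> is a strong limit (for instance the cardinality of a Grothendieck
  universe), this is the same as having fewer than \<open>\<kappa>\<close> points; for other \<open>\<kappa>\<close> it is the
  condition that matches limits of fewer than \<open>\<kappa>\<close> finite spaces, since such a limit may have
  more than \<open>\<kappa>\<close> points.
\<close>

definition small_space :: "'k rel \<Rightarrow> 'p topology \<Rightarrow> bool" where
  "small_space \<kappa> X \<longleftrightarrow>
     (\<exists>\<B>. |\<B>| <o \<kappa> \<and> openin X = arbitrary union_of (\<lambda>U. U \<in> \<B>))"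

text \<open>\<open>Small_Stone_cat \<kappa> L\<close> is \<open>Stone_cat L\<close>, with ``space'' read as ``\<open>\<kappa>\<close>-small space''.\<close>

definition Small_Stone_cat ::
  "'k rel \<Rightarrow> ('f, 'a) algebra \<Rightarrow> ('p topology \<times> ('p \<Rightarrow> 'a set), 'p \<Rightarrow> 'p) category" where
  "Small_Stone_cat \<kappa> L = full_subcategory (Stone_cat L) (\<lambda>(X, v). small_space \<kappa> X)"

text \<open>
  The type \<^typ>\<open>'p\<close> has enough points to carry, up to homeomorphism, every \<open>\<kappa>\<close>-small Stone
  space.  This holds for \<open>'p = 'i set\<close>, and for \<open>'p = 'i\<close> if \<open>\<kappa>\<close> is a strong limit.
\<close>

definition enough_points :: "'i rel \<Rightarrow> 'p itself \<Rightarrow> bool" where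
  "enough_points \<kappa> T \<longleftrightarrow>
     (\<forall>A::'i set. |A| <o \<kappa> \<longrightarrow> |Pow A| \<le>o |UNIV :: 'p set| )"

end

(*
  A finite object is copresentable among the Stone spaces over L: if X is the limit of finite
  objects P j, then by compactness a morphism from X to a finite object, together with its
  condition on the labels, factors through some P j, and two factorizations agree after
  restriction along some arrow k -> j.  Since arrows between pro-objects are
  lim colim Hom (P j) (Q k), taking limits is therefore fully faithful on pro-objects.  It is
  essentially surjective because a Stone space over L is the limit of its quotients by finite sets of
  clopens, where a block U carries the intersection of the labels of its points: the labels
  lie in the finite lattice S(L), so each point has a clopen neighbourhood on which its own
  label is the least one.
*)

theory Submission
  imports Defs
begin

section \<open>Equivalences of categories\<close>

text \<open>Two obstacles shape the proof. The first is size: limits must be carried by the fixed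
  type \<open>'p\<close> and index categories by \<open>'i\<close>. A thread of a diagram is coded
  by its graph, a subset of a set with fewer than \<kappa> elements, and
  \<open>enough_points\<close> embeds all such subsets into \<open>'p\<close>. Conversely, by
  compactness a clopen is a finite union of members of a base with fewer than \<kappa> members, so
  there are fewer than \<kappa> finite sets of clopens and they can be coded in \<open>'i\<close>.
  The second is that a projection X -> P j need not be surjective, so a map on X that is constant on
  its fibres gives a map on its image only. Compactness of the space of threads yields an arrow k ->
  j along which all of P k lands in that image, and the factorization is taken at k.
  \<open>thread_cone\<close> collects conditions on points that imply both the limit property and
  copresentability. Arrow maps are written in the direction from arrows between limits to
  pro-arrows, where no representative has to be chosen.\<close>

lemma
  assumes "is_category C" "a \<in> Obj C"
  shows cat_Id: "Id C a \<in> Hom C a a"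
    and cat_Comp: "\<lbrakk>b \<in> Obj C; c \<in> Obj C; f \<in> Hom C a b; g \<in> Hom C b c\<rbrakk> \<Longrightarrow> Comp C a b c g f \<in> Hom C a c"
    and cat_Id_right: "\<lbrakk>b \<in> Obj C; f \<in> Hom C a b\<rbrakk> \<Longrightarrow> Comp C a a b f (Id C a) = f"
    and cat_Id_left: "\<lbrakk>b \<in> Obj C; f \<in> Hom C a b\<rbrakk> \<Longrightarrow> Comp C a b b (Id C b) f = f"
    and cat_assoc: "\<lbrakk>b \<in> Obj C; c \<in> Obj C; d \<in> Obj C; f \<in> Hom C a b; g \<in> Hom C b c; h \<in> Hom C c d\<rbrakk>
      \<Longrightarrow> Comp C a b d (Comp C b c d h g) f = Comp C a c d h (Comp C a b c g f)"
  using assms by (simp_all add: is_category_def)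

text \<open>Every arrow of \<open>C\<close> is the image under \<Psi> of an arrow of
  \<open>D\<close>, and \<Psi> respects identities and composition, so each category law is the
  image of the same law in \<open>D\<close>. This makes \<open>Pro\<close> a category without any
  computation with germs.\<close>

lemma is_category_transport:
  assumes D: "is_category D"
    and l: "\<And>a. a \<in> Obj C \<Longrightarrow> l a \<in> Obj D"
    and bij: "\<And>a b. \<lbrakk>a \<in> Obj C; b \<in> Obj C\<rbrakk> \<Longrightarrow> bij_betw (\<Psi> a b) (Hom D (l a) (l b)) (Hom C a b)"
    and Id: "\<And>a. a \<in> Obj C \<Longrightarrow> \<Psi> a a (Id D (l a)) = Id C a"
    and Comp: "\<And>a b c f g. \<lbrakk>a \<in> Obj C; b \<in> Obj C; c \<in> Obj C; f \<in> Hom D (l a) (l b); g \<in> Hom D (l b) (l c)\<rbrakk>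
      \<Longrightarrow> \<Psi> a c (Comp D (l a) (l b) (l c) g f) = Comp C a b c (\<Psi> b c g) (\<Psi> a b f)"
  shows "is_category C"
proof -
  have mem: "\<Psi> a b f \<in> Hom C a b" if "a \<in> Obj C" "b \<in> Obj C" "f \<in> Hom D (l a) (l b)" for a b f
    using bij[OF that(1,2)] that(3) by (auto simp: bij_betw_def)
  have ex: "\<exists>f'\<in>Hom D (l a) (l b). f = \<Psi> a b f'" if "a \<in> Obj C" "b \<in> Obj C" "f \<in> Hom C a b" for a b f
    using bij[OF that(1,2)] that(3) by (auto simp: bij_betw_def)
  show ?thesis
    unfolding is_category_def
  proof (intro conjI ballI)
    fix a assume a: "a \<in> Obj C"
    then show "Id C a \<in> Hom C a a"
      using mem[OF a a cat_Id[OF D l[OF a]]] by (simp add: Id)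
  next
    fix a b c f g assume *: "a \<in> Obj C" "b \<in> Obj C" "c \<in> Obj C" "f \<in> Hom C a b" "g \<in> Hom C b c"
    then obtain f' g' where "f' \<in> Hom D (l a) (l b)" "f = \<Psi> a b f'" "g' \<in> Hom D (l b) (l c)" "g = \<Psi> b c g'"
      using ex by metis
    then show "Comp C a b c g f \<in> Hom C a c"
      using * by (simp flip: Comp) (intro mem cat_Comp[OF D] l)
  next
    fix a b f assume *: "a \<in> Obj C" "b \<in> Obj C" "f \<in> Hom C a b"
    then obtain f' where f': "f' \<in> Hom D (l a) (l b)" "f = \<Psi> a b f'"
      using ex by metis
    show "Comp C a a b f (Id C a) = f"
      using * f' by (simp flip: Id Comp add: cat_Id[OF D] l cat_Id_right[OF D])
    show "Comp C a b b (Id C b) f = f"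
      using * f' by (simp flip: Id Comp add: cat_Id[OF D] l cat_Id_left[OF D])
  next
    fix a b c d f g h
    assume *: "a \<in> Obj C" "b \<in> Obj C" "c \<in> Obj C" "d \<in> Obj C" "f \<in> Hom C a b" "g \<in> Hom C b c" "h \<in> Hom C c d"
    then obtain f' g' h' where
      "f' \<in> Hom D (l a) (l b)" "f = \<Psi> a b f'" "g' \<in> Hom D (l b) (l c)" "g = \<Psi> b c g'"
      "h' \<in> Hom D (l c) (l d)" "h = \<Psi> c d h'"
      using ex by metis
    then show "Comp C a c d h (Comp C a b c g f) = Comp C a b d (Comp C b c d h g) f"
      using * by (simp flip: Comp add: l cat_Comp[OF D] cat_assoc[OF D])
  qed
qed

lemma is_functorI:
  assumes "is_category C" "is_category D"
    and "\<And>a. a \<in> Obj C \<Longrightarrow> Fobj F a \<in> Obj D"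
    and "\<And>a b f. \<lbrakk>a \<in> Obj C; b \<in> Obj C; f \<in> Hom C a b\<rbrakk> \<Longrightarrow> Farr F a b f \<in> Hom D (Fobj F a) (Fobj F b)"
    and "\<And>a. a \<in> Obj C \<Longrightarrow> Farr F a a (Id C a) = Id D (Fobj F a)"
    and "\<And>a b c f g. \<lbrakk>a \<in> Obj C; b \<in> Obj C; c \<in> Obj C; f \<in> Hom C a b; g \<in> Hom C b c\<rbrakk> \<Longrightarrow>
        Farr F a c (Comp C a b c g f) =
        Comp D (Fobj F a) (Fobj F b) (Fobj F c) (Farr F b c g) (Farr F a b f)"
  shows "is_functor C D F"
  using assms by (simp add: is_functor_def)

text \<open>
  A fully faithful, essentially surjective functor from \<open>C\<close> to \<open>D\<close>, given by its object map \<open>l\<close>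
  and the inverses \<open>\<Psi> a b\<close> of its arrow maps.  That \<open>C\<close> is a category is then a consequence.
\<close>

lemma equivalent_categoriesI:
  assumes D: "is_category D"
    and l: "\<And>a. a \<in> Obj C \<Longrightarrow> l a \<in> Obj D"
    and bij: "\<And>a b. \<lbrakk>a \<in> Obj C; b \<in> Obj C\<rbrakk> \<Longrightarrow> bij_betw (\<Psi> a b) (Hom D (l a) (l b)) (Hom C a b)"
    and Id: "\<And>a. a \<in> Obj C \<Longrightarrow> \<Psi> a a (Id D (l a)) = Id C a"
    and Comp: "\<And>a b c f g. \<lbrakk>a \<in> Obj C; b \<in> Obj C; c \<in> Obj C; f \<in> Hom D (l a) (l b); g \<in> Hom D (l b) (l c)\<rbrakk>
      \<Longrightarrow> \<Psi> a c (Comp D (l a) (l b) (l c) g f) = Comp C a b c (\<Psi> b c g) (\<Psi> a b f)"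
    and surj: "\<And>d. d \<in> Obj D \<Longrightarrow> \<exists>a\<in>Obj C. \<exists>e. is_iso D (l a) d e"
  shows "equivalent_categories C D"
proof -
  have C: "is_category C"
    using is_category_transport[of D C l \<Psi>] assms by blast
  define \<Phi> where "\<Phi> a b = inv_into (Hom D (l a) (l b)) (\<Psi> a b)" for a b
  have \<Psi>: "\<Psi> a b f \<in> Hom C a b" "\<Phi> a b (\<Psi> a b f) = f"
    if "a \<in> Obj C" "b \<in> Obj C" "f \<in> Hom D (l a) (l b)" for a b f
    using bij[OF that(1,2)] that(3) by (auto simp: bij_betw_def \<Phi>_def)
  have \<Phi>: "\<Phi> a b f \<in> Hom D (l a) (l b)" "\<Psi> a b (\<Phi> a b f) = f"
    if "a \<in> Obj C" "b \<in> Obj C" "f \<in> Hom C a b" for a b f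
    using bij[OF that(1,2)] that(3) unfolding \<Phi>_def
    by (metis bij_betw_def inv_into_into, metis bij_betw_def f_inv_into_f)
  have \<Phi>_Id: "\<Phi> a a (Id C a) = Id D (l a)" if "a \<in> Obj C" for a
    using \<Psi>(2)[OF that that cat_Id[OF D l[OF that]]] that by (simp add: Id)
  have \<Phi>_Comp: "\<Phi> a c (Comp C a b c g f) = Comp D (l a) (l b) (l c) (\<Phi> b c g) (\<Phi> a b f)"
    if "a \<in> Obj C" "b \<in> Obj C" "c \<in> Obj C" "f \<in> Hom C a b" "g \<in> Hom C b c" for a b c f g
    using Comp[of a b c "\<Phi> a b f" "\<Phi> b c g"] \<Psi>(2)[of a c "Comp D (l a) (l b) (l c) (\<Phi> b c g) (\<Phi> a b f)"]
      cat_Comp[OF D, of "l a" "l b" "l c" "\<Phi> a b f" "\<Phi> b c g"] that l \<Phi> by simp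
  obtain s e where s: "\<And>d. d \<in> Obj D \<Longrightarrow> s d \<in> Obj C" and e: "\<And>d. d \<in> Obj D \<Longrightarrow> is_iso D (l (s d)) d (e d)"
    using surj by metis
  then obtain e' where e_Hom: "\<And>d. d \<in> Obj D \<Longrightarrow> e d \<in> Hom D (l (s d)) d"
    and e'_Hom: "\<And>d. d \<in> Obj D \<Longrightarrow> e' d \<in> Hom D d (l (s d))"
    and e'e: "\<And>d. d \<in> Obj D \<Longrightarrow> Comp D (l (s d)) d (l (s d)) (e' d) (e d) = Id D (l (s d))"
    and ee': "\<And>d. d \<in> Obj D \<Longrightarrow> Comp D d (l (s d)) d (e d) (e' d) = Id D d"
    unfolding is_iso_def by metis
  define F where "F = \<lparr>Fobj = l, Farr = \<Phi>\<rparr>"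
  \<comment> \<open>Conjugation of \<open>g\<close> by the chosen isomorphisms \<open>e\<close>; its
    image under \<Psi> is the arrow map of the inverse functor \<open>G\<close>.\<close>
  define cj where
    "cj d d' g = Comp D (l (s d)) d (l (s d')) (Comp D d d' (l (s d')) (e' d') g) (e d)" for d d' g
  define G where "G = \<lparr>Fobj = s, Farr = (\<lambda>d d' g. \<Psi> (s d) (s d') (cj d d' g))\<rparr>"
  define \<eta> where "\<eta> a = \<Psi> a (s (l a)) (e' (l a))" for a
  note cl = cat_Comp[OF D] l s e_Hom e'_Hom
  have cj: "cj d d' g \<in> Hom D (l (s d)) (l (s d'))" if "d \<in> Obj D" "d' \<in> Obj D" "g \<in> Hom D d d'" for d d' g
    unfolding cj_def using that by (intro cl)
  \<comment> \<open>This equation and \<open>cj_e'\<close> below are the naturality squares of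
    \<open>e\<close> and of its inverse; the first gives \<epsilon>, the second gives
    \<eta>.\<close>
  have e_cj: "Comp D (l (s d)) (l (s d')) d' (e d') (cj d d' g) = Comp D (l (s d)) d d' g (e d)"
    if [simp]: "d \<in> Obj D" "d' \<in> Obj D" "g \<in> Hom D d d'" for d d' g
  proof -
    have "Comp D (l (s d)) (l (s d')) d' (e d') (cj d d' g)
        = Comp D (l (s d)) d d' (Comp D d (l (s d')) d' (e d') (Comp D d d' (l (s d')) (e' d') g)) (e d)"
      unfolding cj_def by (intro cat_assoc[OF D, symmetric] cl that)
    also have "Comp D d (l (s d')) d' (e d') (Comp D d d' (l (s d')) (e' d') g)
        = Comp D d d' d' (Comp D d' (l (s d')) d' (e d') (e' d')) g"
      by (intro cat_assoc[OF D, symmetric] cl that)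
    finally show ?thesis
      by (simp add: ee' cat_Id_left[OF D])
  qed
  have cj_e': "Comp D d (l (s d)) (l (s d')) (cj d d' g) (e' d) = Comp D d d' (l (s d')) (e' d') g"
    if [simp]: "d \<in> Obj D" "d' \<in> Obj D" "g \<in> Hom D d d'" for d d' g
  proof -
    have "Comp D d (l (s d)) (l (s d')) (cj d d' g) (e' d)
        = Comp D d d (l (s d')) (Comp D d d' (l (s d')) (e' d') g) (Comp D d (l (s d)) d (e d) (e' d))"
      unfolding cj_def by (intro cat_assoc[OF D] cl that)
    also have "\<dots> = Comp D d d' (l (s d')) (e' d') g"
      by (simp add: ee' cat_Id_right[OF D] cl)
    finally show ?thesis .
  qed
  have cj_Id: "cj d d (Id D d) = Id D (l (s d))" if "d \<in> Obj D" for d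
    using that by (simp add: cj_def cat_Id_right[OF D] e'e cl)
  have cj_Comp: "cj a c (Comp D a b c g f) = Comp D (l (s a)) (l (s b)) (l (s c)) (cj b c g) (cj a b f)"
    if [simp]: "a \<in> Obj D" "b \<in> Obj D" "c \<in> Obj D" "f \<in> Hom D a b" "g \<in> Hom D b c" for a b c f g
  proof -
    have "Comp D (l (s a)) (l (s b)) (l (s c)) (cj b c g) (cj a b f)
        = Comp D (l (s a)) b (l (s c)) (Comp D b c (l (s c)) (e' c) g)
            (Comp D (l (s a)) (l (s b)) b (e b) (cj a b f))"
      unfolding cj_def[of b c] by (intro cat_assoc[OF D] cl cj that)
    also have "\<dots> = Comp D (l (s a)) b (l (s c)) (Comp D b c (l (s c)) (e' c) g) (Comp D (l (s a)) a b f (e a))"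
      by (simp add: e_cj)
    also have "\<dots> = Comp D (l (s a)) a (l (s c)) (Comp D a b (l (s c)) (Comp D b c (l (s c)) (e' c) g) f) (e a)"
      by (intro cat_assoc[OF D, symmetric] cl that)
    also have "Comp D a b (l (s c)) (Comp D b c (l (s c)) (e' c) g) f
        = Comp D a c (l (s c)) (e' c) (Comp D a b c g f)"
      by (intro cat_assoc[OF D] cl that)
    finally show ?thesis
      by (simp add: cj_def)
  qed
  have F: "is_functor C D F"
    by (rule is_functorI) (auto simp: F_def C D l \<Phi> \<Phi>_Id \<Phi>_Comp)
  have G: "is_functor D C G"
    by (rule is_functorI) (auto simp: G_def C D s \<Psi> cj cj_Id cj_Comp Id Comp)
  have \<eta>: "is_natural_iso C C id_functor (comp_functor G F) \<eta>"
    unfolding is_natural_iso_def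
  proof (intro conjI ballI)
    fix a assume a[simp]: "a \<in> Obj C"
    have [simp]: "s (l a) \<in> Obj C" "l a \<in> Obj D" "l (s (l a)) \<in> Obj D"
      by (simp_all add: l s)
    have "Comp C a (s (l a)) a (\<Psi> (s (l a)) a (e (l a))) (\<eta> a) = Id C a"
      by (simp add: \<eta>_def Comp[symmetric] cl ee' Id)
    moreover have "Comp C (s (l a)) a (s (l a)) (\<eta> a) (\<Psi> (s (l a)) a (e (l a))) = Id C (s (l a))"
      by (simp add: \<eta>_def Comp[symmetric] cl e'e Id)
    ultimately show "is_iso C (Fobj id_functor a) (Fobj (comp_functor G F) a) (\<eta> a)"
      using \<Psi>(1)[of "s (l a)" a "e (l a)"] \<Psi>(1)[of a "s (l a)" "e' (l a)"]
      by (auto simp: is_iso_def id_functor_def comp_functor_def F_def G_def \<eta>_def cl)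
  next
    fix a b f assume ab[simp]: "a \<in> Obj C" "b \<in> Obj C" "f \<in> Hom C a b"
    have [simp]: "s (l a) \<in> Obj C" "l a \<in> Obj D" "s (l b) \<in> Obj C" "l b \<in> Obj D"
      by (simp_all add: l s)
    have "Comp C a b (s (l b)) (\<eta> b) f = Comp C a b (s (l b)) (\<eta> b) (\<Psi> a b (\<Phi> a b f))"
      by (simp add: \<Phi>)
    also have "\<dots> = \<Psi> a (s (l b)) (Comp D (l a) (l b) (l (s (l b))) (e' (l b)) (\<Phi> a b f))"
      unfolding \<eta>_def by (simp add: Comp cl \<Phi>)
    also have "\<dots> = \<Psi> a (s (l b)) (Comp D (l a) (l (s (l a))) (l (s (l b))) (cj (l a) (l b) (\<Phi> a b f)) (e' (l a)))"
      by (simp add: cj_e' \<Phi>)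
    also have "\<dots> = Comp C a (s (l a)) (s (l b)) (\<Psi> (s (l a)) (s (l b)) (cj (l a) (l b) (\<Phi> a b f))) (\<eta> a)"
      unfolding \<eta>_def by (simp add: Comp cl \<Phi> cj)
    finally show "Comp C (Fobj id_functor a) (Fobj id_functor b) (Fobj (comp_functor G F) b) (\<eta> b)
          (Farr id_functor a b f) =
        Comp C (Fobj id_functor a) (Fobj (comp_functor G F) a) (Fobj (comp_functor G F) b)
          (Farr (comp_functor G F) a b f) (\<eta> a)"
      by (simp add: id_functor_def comp_functor_def F_def G_def)
  qed
  have \<epsilon>: "is_natural_iso D D (comp_functor F G) id_functor e"
    unfolding is_natural_iso_def
    by (auto simp: id_functor_def comp_functor_def F_def G_def e \<Psi> cj s e_cj)
  show ?thesis
    unfolding equivalent_categories_def using F G \<eta> \<epsilon> by blast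
qed

section \<open>Pro-objects with a limit\<close>

lemma full_subcategory_simps [simp]:
  "Obj (full_subcategory D p) = {a \<in> Obj D. p a}"
  "Hom (full_subcategory D p) = Hom D"
  "Id (full_subcategory D p) = Id D"
  "Comp (full_subcategory D p) = Comp D"
  by (simp_all add: full_subcategory_def)

lemma is_category_full_subcategory: "is_category D \<Longrightarrow> is_category (full_subcategory D p)"
  by (simp add: is_category_def)

text \<open>Germs and pro-arrows involve the category only through its arrows, identities and
  composition, which a full subcategory inherits. They can therefore be computed in
  \<open>D\<close>, where the limits live.\<close>

lemma full_subcategory_pro_simps:
  "germs (full_subcategory D p) P c = germs D P c"
  "germ_rel (full_subcategory D p) P c = germ_rel D P c"
  "push_germ (full_subcategory D p) P c c' g \<gamma> = push_germ D P c c' g \<gamma>"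
  "pro_hom (full_subcategory D p) P Q = pro_hom D P Q"
  "pro_id (full_subcategory D p) P = pro_id D P"
  "pro_comp (full_subcategory D p) P Q R \<psi> \<phi> = pro_comp D P Q R \<psi> \<phi>"
  by (simp_all add: germs_def germ_rel_def push_germ_def pro_hom_def pro_id_def pro_comp_def)

section \<open>Cones, limits and germs\<close>

definition is_cone :: "('o, 'm) category \<Rightarrow> ('i, 'o, 'm) pro_object \<Rightarrow> 'o \<Rightarrow> ('i \<Rightarrow> 'm) \<Rightarrow> bool" where
  "is_cone D P X \<pi> \<longleftrightarrow>
     X \<in> Obj D \<and> (\<forall>j\<in>Obj (index P). \<pi> j \<in> Hom D X (pro_ob P j)) \<and>
     (\<forall>j\<in>Obj (index P). \<forall>k\<in>Obj (index P). \<forall>u\<in>Hom (index P) j k.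
        Comp D X (pro_ob P j) (pro_ob P k) (pro_arr P j k u) (\<pi> j) = \<pi> k)"

definition limit_cone :: "('o, 'm) category \<Rightarrow> ('i, 'o, 'm) pro_object \<Rightarrow> 'o \<Rightarrow> ('i \<Rightarrow> 'm) \<Rightarrow> bool" where
  "limit_cone D P X \<pi> \<longleftrightarrow>
     is_cone D P X \<pi> \<and>
     (\<forall>Y \<rho>. is_cone D P Y \<rho> \<longrightarrow>
        (\<exists>!m. m \<in> Hom D Y X \<and> (\<forall>j\<in>Obj (index P). Comp D Y X (pro_ob P j) (\<pi> j) m = \<rho> j)))"

text \<open>\<open>copresents D P X \<pi> c\<close>: the canonical map \<open>colim\<^sub>j Hom D (P j) c \<rightarrow> Hom D X c\<close> is bijective.\<close>

definition copresents ::
  "('o, 'm) category \<Rightarrow> ('i, 'o, 'm) pro_object \<Rightarrow> 'o \<Rightarrow> ('i \<Rightarrow> 'm) \<Rightarrow> 'o \<Rightarrow> bool" where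
  "copresents D P X \<pi> c \<longleftrightarrow>
     (\<forall>h\<in>Hom D X c. \<exists>(j, f)\<in>germs D P c. Comp D X (pro_ob P j) c f (\<pi> j) = h) \<and>
     (\<forall>(j, f)\<in>germs D P c. \<forall>(j', f')\<in>germs D P c.
        Comp D X (pro_ob P j) c f (\<pi> j) = Comp D X (pro_ob P j') c f' (\<pi> j') \<longrightarrow>
        ((j, f), (j', f')) \<in> germ_rel D P c)"

text \<open>The fibre over \<open>h\<close> of the canonical map in \<open>copresents\<close>. If
  that map is bijective, these fibres are the classes of \<open>germ_rel\<close>, so an element of
  the colimit is named by a single arrow out of \<open>X\<close>.\<close>

definition germ_class ::
  "('o, 'm) category \<Rightarrow> ('i, 'o, 'm) pro_object \<Rightarrow> 'o \<Rightarrow> ('i \<Rightarrow> 'm) \<Rightarrow> 'o \<Rightarrow> 'm \<Rightarrow> ('i \<times> 'm) set" where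
  "germ_class D P X \<pi> c h = {(j, f) \<in> germs D P c. Comp D X (pro_ob P j) c f (\<pi> j) = h}"

text \<open>The composite and the identity both commute with the projections of the limit
  \<open>X\<close>, so they coincide by uniqueness. Exchanging the two cones gives the other half of
  an isomorphism.\<close>

lemma limit_cone_endo:
  assumes D: "is_category D"
    and obs: "\<And>j. j \<in> Obj (index P) \<Longrightarrow> pro_ob P j \<in> Obj D"
    and X: "limit_cone D P X \<pi>" and Y: "is_cone D P Y \<rho>"
    and m: "m \<in> Hom D X Y" "\<And>j. j \<in> Obj (index P) \<Longrightarrow> Comp D X Y (pro_ob P j) (\<rho> j) m = \<pi> j"
    and n: "n \<in> Hom D Y X" "\<And>j. j \<in> Obj (index P) \<Longrightarrow> Comp D Y X (pro_ob P j) (\<pi> j) n = \<rho> j"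
  shows "Comp D X Y X n m = Id D X"
proof -
  have cone: "is_cone D P X \<pi>"
    using X by (simp add: limit_cone_def)
  then have *: "X \<in> Obj D" "\<And>j. j \<in> Obj (index P) \<Longrightarrow> \<pi> j \<in> Hom D X (pro_ob P j)" "Y \<in> Obj D"
    using Y by (auto simp: is_cone_def)
  have "Comp D X X (pro_ob P j) (\<pi> j) (Comp D X Y X n m) = \<pi> j" if j: "j \<in> Obj (index P)" for j
    using cat_assoc[OF D *(1) *(3) *(1) obs[OF j] m(1) n(1) *(2)[OF j]] by (simp add: m n j)
  moreover have "Comp D X X (pro_ob P j) (\<pi> j) (Id D X) = \<pi> j" if j: "j \<in> Obj (index P)" for j
    by (simp add: cat_Id_right[OF D] * obs j)
  ultimately show ?thesis
    using X cone cat_Comp[OF D *(1) *(3) *(1) m(1) n(1)] cat_Id[OF D *(1)]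
    unfolding limit_cone_def by metis
qed

lemma limit_cones_iso:
  assumes D: "is_category D"
    and obs: "\<And>j. j \<in> Obj (index P) \<Longrightarrow> pro_ob P j \<in> Obj D"
    and X: "limit_cone D P X \<pi>" and Y: "limit_cone D P Y \<rho>"
  shows "\<exists>m. is_iso D X Y m"
proof -
  have cones: "is_cone D P X \<pi>" "is_cone D P Y \<rho>"
    using X Y by (auto simp: limit_cone_def)
  obtain m where m: "m \<in> Hom D X Y" "\<And>j. j \<in> Obj (index P) \<Longrightarrow> Comp D X Y (pro_ob P j) (\<rho> j) m = \<pi> j"
    using Y cones(1) unfolding limit_cone_def by metis
  obtain n where n: "n \<in> Hom D Y X" "\<And>j. j \<in> Obj (index P) \<Longrightarrow> Comp D Y X (pro_ob P j) (\<pi> j) n = \<rho> j"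
    using X cones(2) unfolding limit_cone_def by metis
  have "Comp D X Y X n m = Id D X" "Comp D Y X Y m n = Id D Y"
    using limit_cone_endo[OF D obs X cones(2) m n] limit_cone_endo[OF D obs Y cones(1) n m] by auto
  then show ?thesis
    using m(1) n(1) by (auto simp: is_iso_def)
qed

text \<open>\<open>K\<close> plays two roles: it contains the objects of the diagram, and it
  consists of targets on which the canonical map is bijective. Two pro-objects with the same
  \<open>K\<close> can thus be source and target of a pro-arrow.\<close>

locale pro_limit =
  fixes D :: "('o, 'm) category" and P :: "('i, 'o, 'm) pro_object"
    and X :: 'o and \<pi> :: "'i \<Rightarrow> 'm" and K :: "'o set"
  assumes D: "is_category D"
    and diagram: "is_functor (index P) D (diagram P)"
    and limit: "limit_cone D P X \<pi>"
    and copresents: "\<And>c. c \<in> K \<Longrightarrow> copresents D P X \<pi> c"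
    and K: "K \<subseteq> Obj D"
    and pro_ob_K: "\<And>j. j \<in> Obj (index P) \<Longrightarrow> pro_ob P j \<in> K"
begin

lemma pro_ob_Obj: "j \<in> Obj (index P) \<Longrightarrow> pro_ob P j \<in> Obj D"
  using pro_ob_K K by blast

lemma pro_arr_Hom:
  "\<lbrakk>j \<in> Obj (index P); k \<in> Obj (index P); u \<in> Hom (index P) j k\<rbrakk>
    \<Longrightarrow> pro_arr P j k u \<in> Hom D (pro_ob P j) (pro_ob P k)"
  using diagram by (simp add: is_functor_def)

lemma X_Obj: "X \<in> Obj D"
  and \<pi>_Hom: "j \<in> Obj (index P) \<Longrightarrow> \<pi> j \<in> Hom D X (pro_ob P j)"
  and \<pi>_compat: "\<lbrakk>j \<in> Obj (index P); k \<in> Obj (index P); u \<in> Hom (index P) j k\<rbrakk>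
    \<Longrightarrow> Comp D X (pro_ob P j) (pro_ob P k) (pro_arr P j k u) (\<pi> j) = \<pi> k"
  using limit by (simp_all add: limit_cone_def is_cone_def)

text \<open>Germs that agree at some stage \<open>k\<close> agree after composition with
  \<open>\<pi> k\<close>; the converse is the injectivity half of \<open>copresents\<close>. In this
  form the relation is visibly an equivalence.\<close>

lemma germ_rel_eq:
  assumes c: "c \<in> K"
  shows "germ_rel D P c = {((j, f), (j', f')). (j, f) \<in> germs D P c \<and> (j', f') \<in> germs D P c \<and>
     Comp D X (pro_ob P j) c f (\<pi> j) = Comp D X (pro_ob P j') c f' (\<pi> j')}"
    (is "_ = ?R")
proof (intro equalityI subrelI)
  fix a b assume ab: "(a, b) \<in> germ_rel D P c"
  obtain j f j' f' where [simp]: "a = (j, f)" "b = (j', f')"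
    by fastforce
  obtain k u u' where *: "k \<in> Obj (index P)" "u \<in> Hom (index P) k j" "u' \<in> Hom (index P) k j'"
    and eq: "Comp D (pro_ob P k) (pro_ob P j) c f (pro_arr P k j u) =
           Comp D (pro_ob P k) (pro_ob P j') c f' (pro_arr P k j' u')"
    using ab unfolding germ_rel_def by auto
  have mem: "(j, f) \<in> germs D P c" "(j', f') \<in> germs D P c"
    using ab by (auto simp: germ_rel_def)
  have **: "Comp D X (pro_ob P k) c (Comp D (pro_ob P k) (pro_ob P j) c f (pro_arr P k j u)) (\<pi> k)
      = Comp D X (pro_ob P j) c f (\<pi> j)"
    if "u \<in> Hom (index P) k j" "(j, f) \<in> germs D P c" for u j f
  proof -
    have j: "j \<in> Obj (index P)" "f \<in> Hom D (pro_ob P j) c"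
      using that(2) by (auto simp: germs_def)
    have "Comp D X (pro_ob P k) c (Comp D (pro_ob P k) (pro_ob P j) c f (pro_arr P k j u)) (\<pi> k)
      = Comp D X (pro_ob P j) c f (Comp D X (pro_ob P k) (pro_ob P j) (pro_arr P k j u) (\<pi> k))"
      using j *(1) that(1) c K by (intro cat_assoc[OF D] X_Obj \<pi>_Hom pro_ob_Obj pro_arr_Hom) auto
    then show ?thesis
      using j *(1) that(1) by (simp add: \<pi>_compat)
  qed
  show "(a, b) \<in> ?R"
    using **[OF *(2) mem(1)] **[OF *(3) mem(2)] eq mem by simp
next
  fix a b assume "(a, b) \<in> ?R"
  then show "(a, b) \<in> germ_rel D P c"
    using copresents[OF c] unfolding copresents_def by fast
qed

lemma germ_rel_Image:
  assumes "c \<in> K" "(j, f) \<in> germs D P c"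
  shows "germ_rel D P c `` {(j, f)} = germ_class D P X \<pi> c (Comp D X (pro_ob P j) c f (\<pi> j))"
  using assms by (auto simp: germ_rel_eq germ_class_def)

lemma germs_Comp:
  assumes "c \<in> K" "(j, f) \<in> germs D P c"
  shows "Comp D X (pro_ob P j) c f (\<pi> j) \<in> Hom D X c"
  using assms K by (intro cat_Comp[OF D] X_Obj pro_ob_Obj \<pi>_Hom) (auto simp: germs_def)

lemma germ_class_nonempty:
  assumes "c \<in> K" "h \<in> Hom D X c"
  shows "\<exists>j f. (j, f) \<in> germ_class D P X \<pi> c h"
  using copresents[OF assms(1)] assms(2) by (fastforce simp: copresents_def germ_class_def)

lemma germ_class_inject:
  assumes "c \<in> K" "h \<in> Hom D X c" "germ_class D P X \<pi> c h = germ_class D P X \<pi> c h'"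
  shows "h = h'"
  using germ_class_nonempty[OF assms(1,2)] assms(3) by (auto simp: germ_class_def)

lemma germs_quotient:
  assumes "c \<in> K"
  shows "germs D P c // germ_rel D P c = germ_class D P X \<pi> c ` Hom D X c"
proof (intro equalityI subsetI)
  fix \<gamma> assume "\<gamma> \<in> germs D P c // germ_rel D P c"
  then show "\<gamma> \<in> germ_class D P X \<pi> c ` Hom D X c"
    by (auto simp: quotient_def germ_rel_Image[OF assms] germs_Comp[OF assms])
next
  fix \<gamma> assume "\<gamma> \<in> germ_class D P X \<pi> c ` Hom D X c"
  then obtain h where h: "h \<in> Hom D X c" "\<gamma> = germ_class D P X \<pi> c h" by blast
  obtain j f where jf: "(j, f) \<in> germ_class D P X \<pi> c h"
    using germ_class_nonempty[OF assms h(1)] by blast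
  then have "(j, f) \<in> germs D P c" "\<gamma> = germ_rel D P c `` {(j, f)}"
    using h(2) by (auto simp: germ_rel_Image[OF assms] germ_class_def)
  then show "\<gamma> \<in> germs D P c // germ_rel D P c"
    by (auto simp: quotient_def)
qed

lemma push_germ_class:
  assumes c: "c \<in> K" "c' \<in> K" and h: "h \<in> Hom D X c" and g: "g \<in> Hom D c c'"
  shows "push_germ D P c c' g (germ_class D P X \<pi> c h) = germ_class D P X \<pi> c' (Comp D X c c' g h)"
proof -
  have "germ_rel D P c' `` {(j, Comp D (pro_ob P j) c c' g f)} = germ_class D P X \<pi> c' (Comp D X c c' g h)"
    if jf: "(j, f) \<in> germ_class D P X \<pi> c h" for j f
  proof -
    have *: "j \<in> Obj (index P)" "f \<in> Hom D (pro_ob P j) c" "Comp D X (pro_ob P j) c f (\<pi> j) = h"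
      using jf by (auto simp: germ_class_def germs_def)
    have "Comp D (pro_ob P j) c c' g f \<in> Hom D (pro_ob P j) c'"
      using c K g * by (meson cat_Comp[OF D] pro_ob_Obj subsetD)
    then have "(j, Comp D (pro_ob P j) c c' g f) \<in> germs D P c'"
      using * by (simp add: germs_def)
    moreover have "Comp D X (pro_ob P j) c' (Comp D (pro_ob P j) c c' g f) (\<pi> j)
        = Comp D X c c' g (Comp D X (pro_ob P j) c f (\<pi> j))"
      using c K g * by (intro cat_assoc[OF D] X_Obj pro_ob_Obj \<pi>_Hom) auto
    ultimately show ?thesis
      by (simp add: germ_rel_Image[OF c(2)] *)
  qed
  \<comment> \<open>All members of the union in \<open>push_germ\<close> are the same class, and by
    surjectivity of the canonical map the union is not empty.\<close>
  then show ?thesis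
    unfolding push_germ_def using germ_class_nonempty[OF c(1) h] by fast
qed

end

text \<open>The passage from arrows X -> Y to compatible families X -> Q k, followed at each
  \<open>k\<close> by the inverse of the canonical map from the colimit.\<close>

definition lim_arr ::
  "('o, 'm) category \<Rightarrow> ('i, 'o, 'm) pro_object \<Rightarrow> 'o \<Rightarrow> ('i \<Rightarrow> 'm) \<Rightarrow>
   ('i, 'o, 'm) pro_object \<Rightarrow> 'o \<Rightarrow> ('i \<Rightarrow> 'm) \<Rightarrow> 'm \<Rightarrow> 'i \<Rightarrow> ('i \<times> 'm) set" where
  "lim_arr D P X \<pi> Q Y \<rho> m =
     (\<lambda>k\<in>Obj (index Q). germ_class D P X \<pi> (pro_ob Q k) (Comp D X Y (pro_ob Q k) (\<rho> k) m))"

text \<open>A germ class determines the arrow that names it, and the arrows into all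
  \<open>pro_ob Q k\<close> determine \<open>m\<close> because \<open>Y\<close> is a limit; this
  gives injectivity. For surjectivity, compatibility of \<phi> under \<open>push_germ\<close> says
  exactly that the arrows naming its components form a cone.\<close>

lemma lim_arr_bij:
  assumes "pro_limit D P X \<pi> K" "pro_limit D Q Y \<rho> K"
  shows "bij_betw (lim_arr D P X \<pi> Q Y \<rho>) (Hom D X Y) (pro_hom D P Q)"
proof -
  interpret P: pro_limit D P X \<pi> K by fact
  interpret Q: pro_limit D Q Y \<rho> K by fact
  note D = P.D
  have \<rho>m: "Comp D X Y (pro_ob Q k) (\<rho> k) m \<in> Hom D X (pro_ob Q k)"
    if "k \<in> Obj (index Q)" "m \<in> Hom D X Y" for k m
    using that by (intro cat_Comp[OF D] P.X_Obj Q.X_Obj Q.pro_ob_Obj Q.\<pi>_Hom)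
  have cone: "is_cone D Q X (\<lambda>k. Comp D X Y (pro_ob Q k) (\<rho> k) m)" if m: "m \<in> Hom D X Y" for m
    unfolding is_cone_def
  proof (intro conjI ballI P.X_Obj \<rho>m m)
    fix k k' u assume *: "k \<in> Obj (index Q)" "k' \<in> Obj (index Q)" "u \<in> Hom (index Q) k k'"
    have "Comp D X (pro_ob Q k) (pro_ob Q k') (pro_arr Q k k' u) (Comp D X Y (pro_ob Q k) (\<rho> k) m)
      = Comp D X Y (pro_ob Q k') (Comp D Y (pro_ob Q k) (pro_ob Q k') (pro_arr Q k k' u) (\<rho> k)) m"
      using * m by (intro cat_assoc[OF D, symmetric] P.X_Obj Q.X_Obj Q.pro_ob_Obj Q.\<pi>_Hom Q.pro_arr_Hom)
    then show "Comp D X (pro_ob Q k) (pro_ob Q k') (pro_arr Q k k' u) (Comp D X Y (pro_ob Q k) (\<rho> k) m)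
      = Comp D X Y (pro_ob Q k') (\<rho> k') m"
      using * by (simp add: Q.\<pi>_compat)
  qed
  show ?thesis
  proof (intro bij_betw_imageI inj_onI equalityI subsetI)
    fix m n assume mn: "m \<in> Hom D X Y" "n \<in> Hom D X Y"
      and eq: "lim_arr D P X \<pi> Q Y \<rho> m = lim_arr D P X \<pi> Q Y \<rho> n"
    have "Comp D X Y (pro_ob Q k) (\<rho> k) m = Comp D X Y (pro_ob Q k) (\<rho> k) n"
      if k: "k \<in> Obj (index Q)" for k
    proof (rule P.germ_class_inject[OF Q.pro_ob_K[OF k] \<rho>m[OF k mn(1)]])
      show "germ_class D P X \<pi> (pro_ob Q k) (Comp D X Y (pro_ob Q k) (\<rho> k) m)
          = germ_class D P X \<pi> (pro_ob Q k) (Comp D X Y (pro_ob Q k) (\<rho> k) n)"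
        using fun_cong[OF eq, of k] k by (simp add: lim_arr_def)
    qed
    moreover have "\<exists>!m'. m' \<in> Hom D X Y \<and>
        (\<forall>k\<in>Obj (index Q). Comp D X Y (pro_ob Q k) (\<rho> k) m' = Comp D X Y (pro_ob Q k) (\<rho> k) m)"
      using Q.limit cone[OF mn(1)] by (simp add: limit_cone_def)
    ultimately show "m = n"
      using mn by (auto elim!: ex1E)
  next
    fix \<phi> assume "\<phi> \<in> lim_arr D P X \<pi> Q Y \<rho> ` Hom D X Y"
    then obtain m where m: "m \<in> Hom D X Y" "\<phi> = lim_arr D P X \<pi> Q Y \<rho> m" by blast
    have "push_germ D P (pro_ob Q k) (pro_ob Q k') (pro_arr Q k k' u) (\<phi> k) = \<phi> k'"
      if "k \<in> Obj (index Q)" "k' \<in> Obj (index Q)" "u \<in> Hom (index Q) k k'" for k k' u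
      using that m cone[OF m(1)]
      by (simp add: lim_arr_def P.push_germ_class Q.pro_ob_K \<rho>m Q.pro_arr_Hom is_cone_def)
    moreover have "\<phi> \<in> (\<Pi>\<^sub>E k\<in>Obj (index Q). germs D P (pro_ob Q k) // germ_rel D P (pro_ob Q k))"
      using m by (auto simp: lim_arr_def P.germs_quotient Q.pro_ob_K intro!: \<rho>m)
    ultimately show "\<phi> \<in> pro_hom D P Q"
      by (simp add: pro_hom_def)
  next
    fix \<phi> assume \<phi>: "\<phi> \<in> pro_hom D P Q"
    then have "\<forall>k\<in>Obj (index Q). \<exists>h. h \<in> Hom D X (pro_ob Q k) \<and> \<phi> k = germ_class D P X \<pi> (pro_ob Q k) h"
      by (fastforce simp: pro_hom_def P.germs_quotient Q.pro_ob_K PiE_iff)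
    then obtain h where h: "\<And>k. k \<in> Obj (index Q) \<Longrightarrow> h k \<in> Hom D X (pro_ob Q k)"
      "\<And>k. k \<in> Obj (index Q) \<Longrightarrow> \<phi> k = germ_class D P X \<pi> (pro_ob Q k) (h k)"
      by metis
    have "is_cone D Q X h"
      unfolding is_cone_def
    proof (intro conjI ballI P.X_Obj h)
      fix k k' u assume *: "k \<in> Obj (index Q)" "k' \<in> Obj (index Q)" "u \<in> Hom (index Q) k k'"
      have "germ_class D P X \<pi> (pro_ob Q k') (Comp D X (pro_ob Q k) (pro_ob Q k') (pro_arr Q k k' u) (h k))
         = germ_class D P X \<pi> (pro_ob Q k') (h k')"
        using \<phi> * by (simp add: pro_hom_def h P.push_germ_class[symmetric] Q.pro_ob_K Q.pro_arr_Hom)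
      with * show "Comp D X (pro_ob Q k) (pro_ob Q k') (pro_arr Q k k' u) (h k) = h k'"
        by (intro P.germ_class_inject[OF Q.pro_ob_K[OF *(2)]] cat_Comp[OF D] P.X_Obj Q.pro_ob_Obj
            Q.pro_arr_Hom h)
    qed
    then obtain m where m: "m \<in> Hom D X Y" "\<And>k. k \<in> Obj (index Q) \<Longrightarrow> Comp D X Y (pro_ob Q k) (\<rho> k) m = h k"
      using Q.limit unfolding limit_cone_def by metis
    have "\<phi> \<in> extensional (Obj (index Q))"
      using \<phi> by (auto simp: pro_hom_def PiE_def)
    then have "\<phi> = lim_arr D P X \<pi> Q Y \<rho> m"
      by (intro extensionalityI[of _ "Obj (index Q)"]) (auto simp: lim_arr_def h m)
    with m show "\<phi> \<in> lim_arr D P X \<pi> Q Y \<rho> ` Hom D X Y"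
      by blast
  qed
qed

lemma lim_arr_Id:
  assumes "pro_limit D P X \<pi> K"
  shows "lim_arr D P X \<pi> P X \<pi> (Id D X) = pro_id D P"
proof -
  interpret P: pro_limit D P X \<pi> K by fact
  have "germ_rel D P (pro_ob P k) `` {(k, Id D (pro_ob P k))} = germ_class D P X \<pi> (pro_ob P k) (\<pi> k)"
    if k: "k \<in> Obj (index P)" for k
  proof -
    have "(k, Id D (pro_ob P k)) \<in> germs D P (pro_ob P k)"
      using k cat_Id[OF P.D P.pro_ob_Obj[OF k]] by (simp add: germs_def)
    then show ?thesis
      using k by (simp add: P.germ_rel_Image P.pro_ob_K P.\<pi>_Hom P.pro_ob_Obj P.X_Obj cat_Id_left[OF P.D])
  qed
  then show ?thesis
    unfolding lim_arr_def pro_id_def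
    by (intro restrict_ext) (simp add: P.\<pi>_Hom P.X_Obj P.pro_ob_Obj cat_Id_right[OF P.D])
qed

text \<open>The union in \<open>pro_comp\<close> runs over all representatives \<open>(k, g)\<close>
  of a class. Each satisfies g o \<rho> k = \<tau> l o n, so each contributes the class named by
  \<tau> l o n o m.\<close>

lemma lim_arr_Comp:
  assumes "pro_limit D P X \<pi> K" "pro_limit D Q Y \<rho> K" "pro_limit D R Z \<tau> K"
    and m: "m \<in> Hom D X Y" and n: "n \<in> Hom D Y Z"
  shows "lim_arr D P X \<pi> R Z \<tau> (Comp D X Y Z n m)
    = pro_comp D P Q R (lim_arr D Q Y \<rho> R Z \<tau> n) (lim_arr D P X \<pi> Q Y \<rho> m)"
proof -
  interpret P: pro_limit D P X \<pi> K by fact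
  interpret Q: pro_limit D Q Y \<rho> K by fact
  interpret R: pro_limit D R Z \<tau> K by fact
  note D = P.D
  have "(\<Union>(k, g)\<in>lim_arr D Q Y \<rho> R Z \<tau> n l.
          push_germ D P (pro_ob Q k) (pro_ob R l) g (lim_arr D P X \<pi> Q Y \<rho> m k))
      = germ_class D P X \<pi> (pro_ob R l) (Comp D X Z (pro_ob R l) (\<tau> l) (Comp D X Y Z n m))"
    if l: "l \<in> Obj (index R)" for l
  proof -
    have \<tau>n: "Comp D Y Z (pro_ob R l) (\<tau> l) n \<in> Hom D Y (pro_ob R l)"
      using l n by (intro cat_Comp[OF D] Q.X_Obj R.X_Obj R.pro_ob_Obj R.\<pi>_Hom)
    have "push_germ D P (pro_ob Q k) (pro_ob R l) g (lim_arr D P X \<pi> Q Y \<rho> m k)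
       = germ_class D P X \<pi> (pro_ob R l) (Comp D X Z (pro_ob R l) (\<tau> l) (Comp D X Y Z n m))"
      if kg: "(k, g) \<in> germ_class D Q Y \<rho> (pro_ob R l) (Comp D Y Z (pro_ob R l) (\<tau> l) n)" for k g
    proof -
      have *: "k \<in> Obj (index Q)" "g \<in> Hom D (pro_ob Q k) (pro_ob R l)"
        "Comp D Y (pro_ob Q k) (pro_ob R l) g (\<rho> k) = Comp D Y Z (pro_ob R l) (\<tau> l) n"
        using kg by (auto simp: germ_class_def germs_def)
      have "push_germ D P (pro_ob Q k) (pro_ob R l) g (lim_arr D P X \<pi> Q Y \<rho> m k)
          = germ_class D P X \<pi> (pro_ob R l)
              (Comp D X (pro_ob Q k) (pro_ob R l) g (Comp D X Y (pro_ob Q k) (\<rho> k) m))"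
        using *(1,2) l m unfolding lim_arr_def
        by (simp add: P.push_germ_class Q.pro_ob_K R.pro_ob_K cat_Comp[OF D] P.X_Obj Q.X_Obj Q.pro_ob_Obj Q.\<pi>_Hom)
      also have "Comp D X (pro_ob Q k) (pro_ob R l) g (Comp D X Y (pro_ob Q k) (\<rho> k) m)
          = Comp D X Y (pro_ob R l) (Comp D Y (pro_ob Q k) (pro_ob R l) g (\<rho> k)) m"
        using *(1,2) l m
        by (intro cat_assoc[OF D, symmetric] P.X_Obj Q.X_Obj Q.pro_ob_Obj R.pro_ob_Obj Q.\<pi>_Hom)
      also have "\<dots> = Comp D X Z (pro_ob R l) (\<tau> l) (Comp D X Y Z n m)"
        unfolding *(3) using l m n
        by (intro cat_assoc[OF D] P.X_Obj Q.X_Obj R.X_Obj R.pro_ob_Obj R.\<pi>_Hom)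
      finally show ?thesis .
    qed
    then show ?thesis
      using Q.germ_class_nonempty[OF R.pro_ob_K[OF l] \<tau>n] l by (simp add: lim_arr_def) fast
  qed
  from this[symmetric] show ?thesis
    unfolding lim_arr_def[of D P X \<pi> R] pro_comp_def by (rule restrict_ext)
qed

text \<open>The purely categorical core, with \<open>K\<close> the class of objects of
  \<open>C\<close>. The object map picks a limit for each pro-object; an \<open>X\<close> with a
  presentation from \<open>dense\<close> is isomorphic to the picked limit by uniqueness of
  limits.\<close>

lemma Pro_equivalent:
  fixes D :: "('o, 'm) category" and p :: "'o \<Rightarrow> bool" and \<kappa> :: "'i rel"
  defines "C \<equiv> full_subcategory D p"
  assumes D: "is_category D"
    and lim: "\<And>P. is_pro_object \<kappa> C P \<Longrightarrow>
      \<exists>X \<pi>. limit_cone D P X \<pi> \<and> (\<forall>c\<in>Obj C. copresents D P X \<pi> c)"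
    and dense: "\<And>X. X \<in> Obj D \<Longrightarrow> \<exists>P \<pi>. is_pro_object \<kappa> C P \<and> limit_cone D P X \<pi>"
  shows "equivalent_categories (Pro \<kappa> C) D"
proof -
  obtain l \<pi> where l: "\<And>P. is_pro_object \<kappa> C P \<Longrightarrow> limit_cone D P (l P) (\<pi> P)"
    "\<And>P c. \<lbrakk>is_pro_object \<kappa> C P; c \<in> Obj C\<rbrakk> \<Longrightarrow> copresents D P (l P) (\<pi> P) c"
    using lim by metis
  have pro_limit: "pro_limit D P (l P) (\<pi> P) (Obj C)" if P: "is_pro_object \<kappa> C P" for P
    using P D by unfold_locales (auto simp: l is_pro_object_def C_def is_functor_def cofiltered_def)
  have [simp]: "Obj (Pro \<kappa> C) = {P. is_pro_object \<kappa> C P}" "Hom (Pro \<kappa> C) = pro_hom D"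
    "Id (Pro \<kappa> C) = pro_id D" "Comp (Pro \<kappa> C) = pro_comp D"
    by (auto simp: Pro_def C_def full_subcategory_pro_simps fun_eq_iff)
  show ?thesis
  proof (rule equivalent_categoriesI[where l = l and \<Psi> = "\<lambda>P Q. lim_arr D P (l P) (\<pi> P) Q (l Q) (\<pi> Q)"])
    fix X assume "X \<in> Obj D"
    then obtain P \<rho> where P: "is_pro_object \<kappa> C P" "limit_cone D P X \<rho>"
      using dense by blast
    then show "\<exists>P\<in>Obj (Pro \<kappa> C). \<exists>e. is_iso D (l P) X e"
      using limit_cones_iso[OF D pro_limit.pro_ob_Obj[OF pro_limit[OF P(1)]] l(1)[OF P(1)] P(2)] by auto
  qed (auto intro: D pro_limit.X_Obj[OF pro_limit] lim_arr_bij pro_limit lim_arr_Id lim_arr_Comp)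
qed

section \<open>Stone spaces\<close>

lemma compactin_INT_nonempty:
  assumes "compactin X S" "\<And>a. a \<in> A \<Longrightarrow> closedin X (K a)"
    and "\<And>B. \<lbrakk>finite B; B \<subseteq> A\<rbrakk> \<Longrightarrow> S \<inter> \<Inter>(K ` B) \<noteq> {}"
  shows "S \<inter> \<Inter>(K ` A) \<noteq> {}"
proof -
  have "S \<inter> \<Inter>\<F> \<noteq> {}" if "finite \<F>" "\<F> \<subseteq> K ` A" for \<F>
    using finite_subset_image[OF that] assms(3) by blast
  moreover have "\<forall>C\<in>K ` A. closedin X C"
    using assms(2) by blast
  ultimately show ?thesis
    using assms(1) unfolding compactin_fip by blast
qed

section \<open>The category of Stone spaces over an algebra\<close>

lemma Stone_cat_simps:
  "Obj (Stone_cat L) = {A. is_stone_object L A}"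
  "Hom (Stone_cat L) A B = {m \<in> topspace (fst A) \<rightarrow>\<^sub>E topspace (fst B).
     continuous_map (fst A) (fst B) m \<and> (\<forall>x\<in>topspace (fst A). snd B (m x) \<subseteq> snd A x)}"
  "Id (Stone_cat L) A = (\<lambda>x\<in>topspace (fst A). x)"
  "Comp (Stone_cat L) A B C g f = compose (topspace (fst A)) g f"
  by (simp_all add: Stone_cat_def split_beta)

lemma FinSet_cat_simps:
  "Obj (FinSet_cat L) = {A. is_stone_object L A \<and> finite (topspace (fst A))}"
  "Hom (FinSet_cat L) = Hom (Stone_cat L)"
  "Id (FinSet_cat L) = Id (Stone_cat L)"
  "Comp (FinSet_cat L) = Comp (Stone_cat L)"
  by (auto simp: FinSet_cat_def Stone_cat_simps)

lemma Stone_cat_Comp: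
  assumes f: "f \<in> Hom (Stone_cat L) A B" and g: "g \<in> Hom (Stone_cat L) B C"
  shows "compose (topspace (fst A)) g f \<in> Hom (Stone_cat L) A C"
proof -
  have "continuous_map (fst A) (fst C) (g \<circ> f)"
    using f g by (auto simp: Stone_cat_simps intro: continuous_map_compose)
  then have "continuous_map (fst A) (fst C) (compose (topspace (fst A)) g f)"
    by (rule continuous_map_eq) (simp add: compose_def)
  moreover have "snd C (g (f x)) \<subseteq> snd A x" if "x \<in> topspace (fst A)" for x
  proof -
    have "snd C (g (f x)) \<subseteq> snd B (f x)" "snd B (f x) \<subseteq> snd A x"
      using f g that by (auto simp: Stone_cat_simps)
    then show ?thesis by blast
  qed
  ultimately show ?thesis
    using f g by (auto simp: Stone_cat_simps compose_def)
qed

lemma is_category_Stone_cat: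
  fixes L :: "('f, 'a) algebra"
  shows "is_category (Stone_cat L)"
  unfolding is_category_def
proof (intro conjI ballI)
  fix A :: "'p topology \<times> ('p \<Rightarrow> 'a set)"
  have "continuous_map (fst A) (fst A) (\<lambda>x\<in>topspace (fst A). x)"
    by (rule continuous_map_eq[OF continuous_map_id]) auto
  then show "Id (Stone_cat L) A \<in> Hom (Stone_cat L) A A"
    by (auto simp: Stone_cat_simps)
next
  fix A B C :: "'p topology \<times> ('p \<Rightarrow> 'a set)" and f g
  assume "f \<in> Hom (Stone_cat L) A B" "g \<in> Hom (Stone_cat L) B C"
  then show "Comp (Stone_cat L) A B C g f \<in> Hom (Stone_cat L) A C"
    by (simp add: Stone_cat_simps(4) Stone_cat_Comp)
qed (auto simp: Stone_cat_simps PiE_iff Pi_iff intro!: compose_assoc compose_Id Id_compose)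

lemma is_category_FinSet_cat: "is_category (FinSet_cat L)"
  by (simp add: FinSet_cat_def is_category_full_subcategory is_category_Stone_cat)

lemma stone_object_finite_discrete:
  assumes "is_stone_object L A" "finite (topspace (fst A))"
  shows "fst A = discrete_topology (topspace (fst A))"
  using assms
  by (intro finite_t1_space_imp_discrete_topology Hausdorff_imp_t1_space)
    (auto simp: is_stone_object_def stone_space_def split_beta)

text \<open>A point of the limit of the underlying sets. Values outside the index objects are left
  free; extensionality is added where threads have to be points of a product.\<close>

definition thread :: "('i, 'p topology \<times> ('p \<Rightarrow> 'a set), 'p \<Rightarrow> 'p) pro_object \<Rightarrow> ('i \<Rightarrow> 'p) \<Rightarrow> bool" where
  "thread P x \<longleftrightarrow>
     (\<forall>j\<in>Obj (index P). x j \<in> topspace (fst (pro_ob P j))) \<and>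
     (\<forall>j\<in>Obj (index P). \<forall>k\<in>Obj (index P). \<forall>u\<in>Hom (index P) j k. pro_arr P j k u (x j) = x k)"

text \<open>Conditions on points that make a cone a limit: each thread is realised, fibres of single
  projections are a base, and the label of a point is attained at some stage. One projection at a
  time is enough in the base because the index is cofiltered. The realising point is unique since
  the space is Hausdorff.\<close>

definition thread_cone ::
  "('f, 'a) algebra \<Rightarrow> ('i, 'p topology \<times> ('p \<Rightarrow> 'a set), 'p \<Rightarrow> 'p) pro_object \<Rightarrow>
   'p topology \<times> ('p \<Rightarrow> 'a set) \<Rightarrow> ('i \<Rightarrow> 'p \<Rightarrow> 'p) \<Rightarrow> bool" where
  "thread_cone L P A \<pi> \<longleftrightarrow>
     is_cone (Stone_cat L) P A \<pi> \<and>
     (\<forall>x. thread P x \<longrightarrow> (\<exists>y\<in>topspace (fst A). \<forall>j\<in>Obj (index P). \<pi> j y = x j)) \<and>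
     (\<forall>U y. openin (fst A) U \<and> y \<in> U \<longrightarrow>
        (\<exists>j\<in>Obj (index P). {z \<in> topspace (fst A). \<pi> j z = \<pi> j y} \<subseteq> U)) \<and>
     (\<forall>y\<in>topspace (fst A). \<exists>j\<in>Obj (index P). snd A y \<subseteq> snd (pro_ob P j) (\<pi> j y))"

section \<open>Cofiltered diagrams of finite objects and their threads\<close>

locale finset_pro =
  fixes L :: "('f, 'a) algebra"
    and P :: "('i, 'p topology \<times> ('p \<Rightarrow> 'a set), 'p \<Rightarrow> 'p) pro_object"
  assumes diagram: "is_functor (index P) (FinSet_cat L) (diagram P)"
    and cofiltered: "cofiltered (index P)"
begin

abbreviation "I \<equiv> index P"
abbreviation "J \<equiv> Obj (index P)"
abbreviation "arr j k \<equiv> Hom (index P) j k"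
abbreviation "pt j \<equiv> topspace (fst (pro_ob P j))"
abbreviation "lab j \<equiv> snd (pro_ob P j)"

lemma is_category_index: "is_category (index P)"
  using diagram by (simp add: is_functor_def)

lemma pro_ob_Stone: "j \<in> J \<Longrightarrow> is_stone_object L (pro_ob P j)"
  and finite_pt: "j \<in> J \<Longrightarrow> finite (pt j)"
  using diagram by (auto simp: is_functor_def FinSet_cat_simps)

lemma discrete: "j \<in> J \<Longrightarrow> fst (pro_ob P j) = discrete_topology (pt j)"
  by (rule stone_object_finite_discrete[OF pro_ob_Stone finite_pt])

lemma openin_singleton: "\<lbrakk>j \<in> J; p \<in> pt j\<rbrakk> \<Longrightarrow> openin (fst (pro_ob P j)) {p}"
  by (subst discrete) simp_all

lemma subalgebra_lab: "\<lbrakk>j \<in> J; p \<in> pt j\<rbrakk> \<Longrightarrow> subalgebra L (lab j p)"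
  using pro_ob_Stone[of j] by (auto simp: is_stone_object_def split_beta)

lemma
  assumes "j \<in> J" "k \<in> J" "u \<in> arr j k"
  shows pro_arr_Hom: "pro_arr P j k u \<in> Hom (Stone_cat L) (pro_ob P j) (pro_ob P k)"
    and pro_arr_pt: "p \<in> pt j \<Longrightarrow> pro_arr P j k u p \<in> pt k"
    and lab_pro_arr: "p \<in> pt j \<Longrightarrow> lab k (pro_arr P j k u p) \<subseteq> lab j p"
proof -
  show *: "pro_arr P j k u \<in> Hom (Stone_cat L) (pro_ob P j) (pro_ob P k)"
    using diagram assms by (simp add: is_functor_def FinSet_cat_simps)
  show "p \<in> pt j \<Longrightarrow> pro_arr P j k u p \<in> pt k" "p \<in> pt j \<Longrightarrow> lab k (pro_arr P j k u p) \<subseteq> lab j p"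
    using * by (auto simp: Stone_cat_simps)
qed

lemma pro_arr_Comp:
  "\<lbrakk>i \<in> J; j \<in> J; k \<in> J; u \<in> arr i j; v \<in> arr j k; p \<in> pt i\<rbrakk> \<Longrightarrow>
    pro_arr P i k (Comp I i j k v u) p = pro_arr P j k v (pro_arr P i j u p)"
  using diagram by (simp add: is_functor_def FinSet_cat_simps Stone_cat_simps compose_def)

lemma finite_lower_bound:
  assumes "finite F" "F \<subseteq> J"
  shows "\<exists>k\<in>J. \<exists>c. \<forall>i\<in>F. c i \<in> arr k i"
  using assms
proof (induction F)
  case empty
  then show ?case
    using cofiltered by (auto simp: cofiltered_def)
next
  case (insert i F)
  then obtain k c where k: "k \<in> J" and c: "\<forall>i\<in>F. c i \<in> arr k i"
    by auto
  obtain l u v where l: "l \<in> J" "u \<in> arr l k" "v \<in> arr l i"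
    using cofiltered k insert.prems unfolding cofiltered_def by blast
  let ?c = "\<lambda>x. if x = i then v else Comp I l k x (c x) u"
  have "\<forall>x\<in>insert i F. ?c x \<in> arr l x"
    using insert.prems k c l by (auto intro!: cat_Comp[OF is_category_index])
  then show ?case
    by (intro bexI[of _ l] exI[of _ ?c]) (use l in auto)
qed

text \<open>Induction on the set of arrows: each new triangle is made to commute by equalising its
  two sides, and precomposing all legs with the equaliser keeps the earlier triangles
  commutative.\<close>

lemma finite_diagram_cone:
  assumes "finite A" "finite F" "F \<subseteq> J" "\<And>i k u. (i, k, u) \<in> A \<Longrightarrow> i \<in> F \<and> k \<in> F \<and> u \<in> arr i k"
  shows "\<exists>l\<in>J. \<exists>c. (\<forall>i\<in>F. c i \<in> arr l i) \<and> (\<forall>(i, k, u)\<in>A. Comp I l i k u (c i) = c k)"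
  using assms(1,4)
proof (induction A)
  case empty
  then show ?case
    using finite_lower_bound[OF assms(2,3)] by simp
next
  case (insert a A)
  obtain i k u where [simp]: "a = (i, k, u)"
    by (cases a) auto
  have iku: "i \<in> F" "k \<in> F" "u \<in> arr i k"
    using insert.prems by auto
  obtain l c where l: "l \<in> J" and c: "\<And>i. i \<in> F \<Longrightarrow> c i \<in> arr l i"
    and A: "\<And>i k u. (i, k, u) \<in> A \<Longrightarrow> Comp I l i k u (c i) = c k"
    using insert.IH insert.prems by fastforce
  have "Comp I l i k u (c i) \<in> arr l k"
    using iku assms(3) by (intro cat_Comp[OF is_category_index] l c) auto
  then obtain m h where m: "m \<in> J" "h \<in> arr m l" "Comp I m l k (Comp I l i k u (c i)) h = Comp I m l k (c k) h"
    using cofiltered l iku c[OF iku(2)] assms(3) unfolding cofiltered_def by blast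
  let ?c = "\<lambda>x. Comp I m l x (c x) h"
  have "Comp I m i' k' u' (?c i') = ?c k'" if "(i', k', u') \<in> insert a A" for i' k' u'
  proof -
    have *: "i' \<in> F" "k' \<in> F" "u' \<in> arr i' k'"
      using insert.prems[OF that] by auto
    then have "Comp I m i' k' u' (?c i') = Comp I m l k' (Comp I l i' k' u' (c i')) h"
      using assms(3) by (intro cat_assoc[OF is_category_index, symmetric] m l c) auto
    then show ?thesis
      using that m(3) A by auto
  qed
  moreover have "\<forall>i\<in>F. ?c i \<in> arr m i"
    using assms(3) by (auto intro!: cat_Comp[OF is_category_index] m l c)
  ultimately show ?case
    using m(1) by (intro bexI[of _ m] exI[of _ ?c]) auto
qed

lemma lower_bound:
  assumes "i \<in> J" "j \<in> J"
  obtains k u v where "k \<in> J" "u \<in> arr k i" "v \<in> arr k j"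
  using cofiltered assms unfolding cofiltered_def by blast

lemma weak_pullback:
  assumes "i \<in> J" "j \<in> J" "k \<in> J" "u \<in> arr i k" "v \<in> arr j k"
  obtains l u' v' where "l \<in> J" "u' \<in> arr l i" "v' \<in> arr l j" "Comp I l i k u u' = Comp I l j k v v'"
  using finite_diagram_cone[of "{(i, k, u), (j, k, v)}" "{i, j, k}"] assms by fastforce

definition prod_space :: "('i \<Rightarrow> 'p) topology" where
  "prod_space = product_topology (\<lambda>i. fst (pro_ob P i)) J"

text \<open>One closed set per arrow, so that the finite intersection property only ever meets
  finitely many arrows; their common intersection is the set of threads.\<close>

definition compat_set :: "'i \<times> 'i \<times> 'i \<Rightarrow> ('i \<Rightarrow> 'p) set" where
  "compat_set = (\<lambda>(i, k, u). {x \<in> topspace prod_space. pro_arr P i k u (x i) = x k})"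

definition arrows :: "('i \<times> 'i \<times> 'i) set" where
  "arrows = {(i, k, u). i \<in> J \<and> k \<in> J \<and> u \<in> arr i k}"

lemma prod_space_proj: "i \<in> J \<Longrightarrow> continuous_map prod_space (fst (pro_ob P i)) (\<lambda>x. x i)"
  unfolding prod_space_def by (rule continuous_map_product_projection)

lemma compact_prod_space: "compact_space prod_space"
  using pro_ob_Stone unfolding prod_space_def compact_space_product_topology
  by (auto simp: is_stone_object_def stone_space_def split_beta)

lemma closedin_compat_set:
  assumes "a \<in> arrows"
  shows "closedin prod_space (compat_set a)"
proof -
  obtain i k u where a: "a = (i, k, u)" "i \<in> J" "k \<in> J" "u \<in> arr i k"
    using assms unfolding arrows_def by blast
  have "continuous_map prod_space (fst (pro_ob P k)) (pro_arr P i k u \<circ> (\<lambda>x. x i))"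
    using pro_arr_Hom[OF a(2-)]
    by (intro continuous_map_compose[OF prod_space_proj[OF a(2)]]) (auto simp: Stone_cat_simps)
  moreover have "Hausdorff_space (fst (pro_ob P k))"
    using pro_ob_Stone[OF a(3)] by (auto simp: is_stone_object_def stone_space_def split_beta)
  ultimately show ?thesis
    using closedin_continuous_maps_eq[OF _ _ prod_space_proj[OF a(3)]] by (simp add: compat_set_def a(1) o_def)
qed

lemma thread_iff: "x \<in> topspace prod_space \<inter> \<Inter>(compat_set ` arrows) \<longleftrightarrow> x \<in> extensional J \<and> thread P x"
proof -
  have "x \<in> \<Inter>(compat_set ` arrows) \<longleftrightarrow> (\<forall>i\<in>J. \<forall>k\<in>J. \<forall>u\<in>arr i k. x \<in> compat_set (i, k, u))"
    by (auto simp: arrows_def)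
  moreover have "x \<in> topspace prod_space \<longleftrightarrow> (\<forall>i\<in>J. x i \<in> pt i) \<and> x \<in> extensional J"
    by (auto simp: prod_space_def PiE_iff)
  moreover have "x \<in> compat_set (i, k, u) \<longleftrightarrow> x \<in> topspace prod_space \<and> pro_arr P i k u (x i) = x k" for i k u
    by (simp add: compat_set_def)
  ultimately show ?thesis
    unfolding thread_def by blast
qed

text \<open>For finitely many arrows, take a cone over them with vertex \<open>l\<close>, lift
  \<open>p\<close> to a point of \<open>pt l\<close> and push that point down the legs. Compactness
  of the product then handles all arrows together.\<close>

lemma thread_exists:
  assumes j: "j \<in> J" and p: "p \<in> pt j"
    and surj: "\<And>k u. \<lbrakk>k \<in> J; u \<in> arr k j\<rbrakk> \<Longrightarrow> p \<in> pro_arr P k j u ` pt k"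
  shows "\<exists>x. thread P x \<and> x j = p"
proof -
  define K0 where "K0 = {x \<in> topspace prod_space. x j = p}"
  have closed: "closedin prod_space K0"
  proof -
    have "K0 = {x \<in> topspace prod_space. x j \<in> {p}}"
      by (auto simp: K0_def)
    moreover have "closedin (fst (pro_ob P j)) {p}"
      using p by (subst discrete[OF j]) simp
    ultimately show ?thesis
      using closedin_continuous_map_preimage[OF prod_space_proj[OF j], of "{p}"] by simp
  qed
  have fip: "K0 \<inter> \<Inter>(compat_set ` B) \<noteq> {}" if B: "finite B" "B \<subseteq> arrows" for B
  proof -
    \<comment> \<open>\<open>j\<close> is included so that the cone has a leg \<open>c j\<close>,
      along which \<open>p\<close> is lifted.\<close>
    define F where "F = insert j (fst ` B \<union> (fst \<circ> snd) ` B)"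
    have "i \<in> F \<and> k \<in> F \<and> i \<in> J \<and> k \<in> J \<and> u \<in> arr i k" if iku: "(i, k, u) \<in> B" for i k u
      using subsetD[OF B(2) iku] image_eqI[OF _ iku, of _ fst] image_eqI[OF _ iku, of _ "fst \<circ> snd"]
      by (simp add: F_def arrows_def)
    moreover have "finite F" "F \<subseteq> J"
      using B j by (auto simp: F_def arrows_def)
    ultimately have F: "finite F" "F \<subseteq> J" "\<And>i k u. (i, k, u) \<in> B \<Longrightarrow> i \<in> F \<and> k \<in> F \<and> u \<in> arr i k"
      by auto
    obtain l c where l: "l \<in> J" and c: "\<forall>i\<in>F. c i \<in> arr l i"
      and cB: "\<forall>(i, k, u)\<in>B. Comp I l i k u (c i) = c k"
      using finite_diagram_cone[OF B(1) F] by blast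
    obtain z where z: "z \<in> pt l" "p = pro_arr P l j (c j) z"
      using surj[OF l] c by (auto simp: F_def)
    have ne: "pt i \<noteq> {}" if i: "i \<in> J" for i
    proof -
      obtain k u v where k: "k \<in> J" "u \<in> arr k i" "v \<in> arr k j"
        using lower_bound[OF i j] .
      then show ?thesis
        using surj[OF k(1,3)] pro_arr_pt[OF k(1) i k(2)] by blast
    qed
    \<comment> \<open>The finitely many arrows only see coordinates in \<open>F\<close>; elsewhere
      any point will do, and one exists because \<open>p\<close> lifts to a common lower bound of
      \<open>i\<close> and \<open>j\<close>.\<close>
    define x where "x = (\<lambda>i\<in>J. if i \<in> F then pro_arr P l i (c i) z else SOME q. q \<in> pt i)"
    have "x i \<in> pt i" if "i \<in> J" for i
      using that ne c l z(1) by (auto simp: x_def some_in_eq intro!: pro_arr_pt)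
    then have x: "x \<in> topspace prod_space"
      by (auto simp: prod_space_def x_def)
    have "x \<in> compat_set b" if b: "b \<in> B" for b
    proof -
      obtain i k u where [simp]: "b = (i, k, u)"
        by (cases b) auto
      have *: "i \<in> F" "k \<in> F" "u \<in> arr i k" "i \<in> J" "k \<in> J"
        using F b by auto
      have "pro_arr P i k u (pro_arr P l i (c i) z) = pro_arr P l k (Comp I l i k u (c i)) z"
        using * c l z by (intro pro_arr_Comp[symmetric]) auto
      also have "\<dots> = pro_arr P l k (c k) z"
        using cB b by auto
      finally show ?thesis
        using * x by (simp add: compat_set_def x_def)
    qed
    moreover have "x \<in> K0"
      using x j z(2) by (simp add: K0_def x_def F_def)
    ultimately show ?thesis
      by blast
  qed
  have "K0 \<inter> \<Inter>(compat_set ` arrows) \<noteq> {}"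
    by (rule compactin_INT_nonempty[OF closedin_compact_space[OF compact_prod_space closed] closedin_compat_set fip])
  then obtain x where "x \<in> K0" "x \<in> \<Inter>(compat_set ` arrows)"
    by blast
  moreover from this have "x j = p" "x \<in> topspace prod_space"
    by (simp_all add: K0_def)
  ultimately have "thread P x" "x j = p"
    using thread_iff[of x] by blast+
  then show ?thesis
    by blast
qed

end

section \<open>Universal property and copresentability of thread cones\<close>

locale finset_thread_cone = finset_pro L P for L :: "('f, 'a) algebra"
    and P :: "('i, 'p topology \<times> ('p \<Rightarrow> 'a set), 'p \<Rightarrow> 'p) pro_object" +
  fixes A :: "'p topology \<times> ('p \<Rightarrow> 'a set)" and \<pi> :: "'i \<Rightarrow> 'p \<Rightarrow> 'p"
  assumes cone: "thread_cone L P A \<pi>"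
begin

abbreviation "X \<equiv> topspace (fst A)"

lemma A_Stone: "is_stone_object L A"
  using cone by (simp add: thread_cone_def is_cone_def Stone_cat_simps)

lemma compact: "compact_space (fst A)" and Hausdorff: "Hausdorff_space (fst A)"
  using A_Stone by (auto simp: is_stone_object_def stone_space_def split_beta)

lemma \<pi>_Hom: "j \<in> J \<Longrightarrow> \<pi> j \<in> Hom (Stone_cat L) A (pro_ob P j)"
  using cone by (simp add: thread_cone_def is_cone_def)

lemma \<pi>_pt: "\<lbrakk>j \<in> J; x \<in> X\<rbrakk> \<Longrightarrow> \<pi> j x \<in> pt j"
  and \<pi>_continuous: "j \<in> J \<Longrightarrow> continuous_map (fst A) (fst (pro_ob P j)) (\<pi> j)"
  using \<pi>_Hom by (auto simp: Stone_cat_simps)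

lemma pro_arr_\<pi>:
  assumes "j \<in> J" "k \<in> J" "u \<in> arr j k" "x \<in> X"
  shows "pro_arr P j k u (\<pi> j x) = \<pi> k x"
proof -
  have "compose X (pro_arr P j k u) (\<pi> j) = \<pi> k"
    using cone assms by (simp add: thread_cone_def is_cone_def Stone_cat_simps)
  then show ?thesis
    using assms(4) by (metis compose_eq)
qed

lemma ex_point: "thread P x \<Longrightarrow> \<exists>y\<in>X. \<forall>j\<in>J. \<pi> j y = x j"
  using cone by (simp add: thread_cone_def)

lemma ex_fibre: "\<lbrakk>openin (fst A) U; x \<in> U\<rbrakk> \<Longrightarrow> \<exists>j\<in>J. \<forall>y\<in>X. \<pi> j y = \<pi> j x \<longrightarrow> y \<in> U"
  using cone by (fastforce simp: thread_cone_def)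

lemma ex_lab: "x \<in> X \<Longrightarrow> \<exists>j\<in>J. snd A x \<subseteq> lab j (\<pi> j x)"
  using cone by (simp add: thread_cone_def)

lemma point_unique:
  assumes "x \<in> X" "y \<in> X" "\<And>j. j \<in> J \<Longrightarrow> \<pi> j x = \<pi> j y"
  shows "x = y"
proof (rule ccontr)
  assume "x \<noteq> y"
  then obtain U where U: "openin (fst A) U" "x \<in> U" "y \<notin> U"
    using Hausdorff assms(1,2) unfolding Hausdorff_space_def disjnt_iff by metis
  then show False
    using ex_fibre[OF U(1,2)] assms by metis
qed

lemma open_fibre:
  assumes "j \<in> J"
  shows "openin (fst A) {y \<in> X. \<pi> j y = p}"
proof -
  have "openin (fst (pro_ob P j)) ({p} \<inter> pt j)"
    by (subst discrete[OF assms]) auto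
  then have "openin (fst A) {y \<in> X. \<pi> j y \<in> {p} \<inter> pt j}"
    by (rule openin_continuous_map_preimage[OF \<pi>_continuous[OF assms]])
  moreover have "{y \<in> X. \<pi> j y \<in> {p} \<inter> pt j} = {y \<in> X. \<pi> j y = p}"
    using \<pi>_pt[OF assms] by auto
  ultimately show ?thesis
    by simp
qed

text \<open>A point \<open>y\<close> of another cone yields the thread of its projections, and the
  mediating map sends \<open>y\<close> to the point realising it. Continuity is tested on fibres of
  single projections, and the label inequality at a stage where the label is attained.\<close>

lemma limit_cone: "limit_cone (Stone_cat L) P A \<pi>"
  unfolding limit_cone_def
proof (intro conjI allI impI)
  show "is_cone (Stone_cat L) P A \<pi>"
    using cone by (simp add: thread_cone_def)
  fix B \<rho> assume B: "is_cone (Stone_cat L) P B \<rho>"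
  let ?Y = "topspace (fst B)"
  have \<rho>: "\<rho> j \<in> Hom (Stone_cat L) B (pro_ob P j)" if "j \<in> J" for j
    using B that by (simp add: is_cone_def)
  have \<rho>_compat: "pro_arr P j k u (\<rho> j y) = \<rho> k y"
    if "j \<in> J" "k \<in> J" "u \<in> arr j k" "y \<in> ?Y" for j k u y
  proof -
    have "compose ?Y (pro_arr P j k u) (\<rho> j) = \<rho> k"
      using B that by (simp add: is_cone_def Stone_cat_simps)
    then show ?thesis
      using that(4) by (metis compose_eq)
  qed
  have "thread P (\<lambda>j. \<rho> j y)" if "y \<in> ?Y" for y
    using \<rho> \<rho>_compat that by (auto simp: thread_def Stone_cat_simps)
  then have "\<forall>y\<in>?Y. \<exists>x\<in>X. \<forall>j\<in>J. \<pi> j x = \<rho> j y"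
    using ex_point by blast
  then obtain m0 where m0: "\<And>y. y \<in> ?Y \<Longrightarrow> m0 y \<in> X" "\<And>y j. \<lbrakk>y \<in> ?Y; j \<in> J\<rbrakk> \<Longrightarrow> \<pi> j (m0 y) = \<rho> j y"
    by metis
  define m where "m = restrict m0 ?Y"
  have m: "m y \<in> X" "j \<in> J \<Longrightarrow> \<pi> j (m y) = \<rho> j y" if "y \<in> ?Y" for y j
    using m0 that by (auto simp: m_def)
  have "continuous_map (fst B) (fst A) m"
    unfolding continuous_map_def
  proof (intro conjI allI impI)
    fix U assume U: "openin (fst A) U"
    show "openin (fst B) {y \<in> ?Y. m y \<in> U}"
    proof (subst openin_subopen, safe)
      fix y assume y: "y \<in> ?Y" "m y \<in> U"
      obtain j where j: "j \<in> J" "\<And>x. \<lbrakk>x \<in> X; \<pi> j x = \<pi> j (m y)\<rbrakk> \<Longrightarrow> x \<in> U"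
        using ex_fibre[OF U y(2)] by blast
      have "openin (fst B) {z \<in> ?Y. \<rho> j z \<in> {\<rho> j y}}"
      proof (rule openin_continuous_map_preimage)
        show "continuous_map (fst B) (fst (pro_ob P j)) (\<rho> j)" "openin (fst (pro_ob P j)) {\<rho> j y}"
          using \<rho>[OF j(1)] y by (auto simp: Stone_cat_simps intro!: openin_singleton[OF j(1)])
      qed
      moreover have "{z \<in> ?Y. \<rho> j z \<in> {\<rho> j y}} \<subseteq> {z \<in> ?Y. m z \<in> U}"
        using j m y by auto
      ultimately show "\<exists>T. openin (fst B) T \<and> y \<in> T \<and> T \<subseteq> {z \<in> ?Y. m z \<in> U}"
        using y(1) by blast
    qed
  qed (use m in auto)
  moreover have "snd A (m y) \<subseteq> snd B y" if y: "y \<in> ?Y" for y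
  proof -
    obtain j where j: "j \<in> J" "snd A (m y) \<subseteq> lab j (\<pi> j (m y))"
      using ex_lab[OF m(1)[OF y]] by blast
    then show ?thesis
      using \<rho>[OF j(1)] y by (auto simp: m Stone_cat_simps)
  qed
  ultimately have mHom: "m \<in> Hom (Stone_cat L) B A"
    using m by (auto simp: Stone_cat_simps m_def)
  show "\<exists>!m. m \<in> Hom (Stone_cat L) B A \<and>
      (\<forall>j\<in>J. Comp (Stone_cat L) B A (pro_ob P j) (\<pi> j) m = \<rho> j)"
  proof (intro ex1I conjI ballI)
    show "Comp (Stone_cat L) B A (pro_ob P j) (\<pi> j) m = \<rho> j" if "j \<in> J" for j
      using \<rho>[OF that] m that
      by (intro extensionalityI[of _ ?Y]) (auto simp: Stone_cat_simps compose_def PiE_iff)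
    fix n assume n: "n \<in> Hom (Stone_cat L) B A \<and>
      (\<forall>j\<in>J. Comp (Stone_cat L) B A (pro_ob P j) (\<pi> j) n = \<rho> j)"
    have "n y = m y" if y: "y \<in> ?Y" for y
    proof (rule point_unique)
      fix j assume "j \<in> J"
      then have "compose ?Y (\<pi> j) n = \<rho> j"
        using n by (simp add: Stone_cat_simps)
      then show "\<pi> j (n y) = \<pi> j (m y)"
        using m(2)[OF y \<open>j \<in> J\<close>] y by (metis compose_eq)
    qed (use n m y in \<open>auto simp: Stone_cat_simps\<close>)
    then show "n = m"
      using n mHom by (intro extensionalityI[of _ ?Y]) (auto simp: Stone_cat_simps PiE_iff)
  qed (rule mHom)
qed

text \<open>
  The projections need not be surjective, but the points of \<open>P j\<close> outside the image of \<open>\<pi> j\<close> are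
  finitely many, and each of them fails to lift along some arrow into \<open>j\<close>.
\<close>

lemma ex_arr_into_image:
  assumes j: "j \<in> J"
  shows "\<exists>k\<in>J. \<exists>u\<in>arr k j. pro_arr P k j u ` pt k \<subseteq> \<pi> j ` X"
proof -
  \<comment> \<open>The points outside the image are avoided one at a time, by induction on a finite
    set \<open>B\<close> of them.\<close>
  have "\<exists>k\<in>J. \<exists>u\<in>arr k j. pro_arr P k j u ` pt k \<inter> B = {}" if "finite B" "B \<subseteq> pt j - \<pi> j ` X" for B
    using that
  proof (induction B)
    case empty
    then show ?case
      using j cat_Id[OF is_category_index] by auto
  next
    case (insert p B)
    then obtain k u where k: "k \<in> J" "u \<in> arr k j" "pro_arr P k j u ` pt k \<inter> B = {}"
      by auto
    \<comment> \<open>A thread through \<open>p\<close> would be realised by a point of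
      \<open>X\<close> and put \<open>p\<close> into the image of \<open>\<pi> j\<close>; so by
      \<open>thread_exists\<close> some arrow into \<open>j\<close> misses \<open>p\<close>.\<close>
    have "\<not> (\<exists>x. thread P x \<and> x j = p)"
      using ex_point insert.prems j by (metis DiffD2 imageI insert_subset)
    then obtain k' u' where k': "k' \<in> J" "u' \<in> arr k' j" "p \<notin> pro_arr P k' j u' ` pt k'"
      using thread_exists[OF j] insert.prems by blast
    \<comment> \<open>A mere lower bound is not enough: one and the same arrow into \<open>j\<close>
      must factor through both \<open>u\<close> and \<open>u'\<close>, so as to avoid
      \<open>B\<close> and \<open>p\<close> together.\<close>
    obtain l v v' where l: "l \<in> J" "v \<in> arr l k" "v' \<in> arr l k'"
      "Comp I l k j u v = Comp I l k' j u' v'"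
      by (rule weak_pullback[OF k(1) k'(1) j k(2) k'(2)])
    let ?w = "Comp I l k j u v"
    have w: "?w \<in> arr l j"
      using l k j by (intro cat_Comp[OF is_category_index])
    have "pro_arr P l j ?w q \<in> pro_arr P k j u ` pt k" if "q \<in> pt l" for q
      using that l(1,2) k(1,2) j by (simp add: pro_arr_Comp pro_arr_pt)
    moreover have "pro_arr P l j ?w q \<in> pro_arr P k' j u' ` pt k'" if "q \<in> pt l" for q
      unfolding l(4) using that l(1,3) k'(1,2) j by (simp add: pro_arr_Comp pro_arr_pt)
    ultimately have "pro_arr P l j ?w ` pt l \<inter> insert p B = {}"
      using k(3) k'(3) by blast
    with l(1) w show ?case
      by blast
  qed
  from this[of "pt j - \<pi> j ` X"] obtain k u where
    "k \<in> J" "u \<in> arr k j" "pro_arr P k j u ` pt k \<inter> (pt j - \<pi> j ` X) = {}"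
    using finite_pt[OF j] by auto
  moreover from this have "pro_arr P k j u ` pt k \<subseteq> pt j"
    using j by (auto intro: pro_arr_pt)
  ultimately show ?thesis
    by blast
qed

lemma germs_iff: "(j, f) \<in> germs (Stone_cat L) P C \<longleftrightarrow> j \<in> J \<and> f \<in> Hom (Stone_cat L) (pro_ob P j) C"
  by (simp add: germs_def)

text \<open>Around each point some stage determines \<open>h\<close> and bounds its label.
  Compactness reduces these to one stage \<open>j\<close>, and passing to a stage whose points land
  in the image of \<open>\<pi> j\<close> turns this into a map on a whole finite object.\<close>

lemma ex_germ:
  assumes C: "C \<in> Obj (FinSet_cat L)" and h: "h \<in> Hom (Stone_cat L) A C"
  shows "\<exists>(j, f)\<in>germs (Stone_cat L) P C. compose X f (\<pi> j) = h"
proof -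
  have C_discrete: "fst C = discrete_topology (topspace (fst C))"
    by (rule stone_object_finite_discrete[of L]) (use C in \<open>simp_all add: FinSet_cat_simps\<close>)
  have h': "h x \<in> topspace (fst C)" "snd C (h x) \<subseteq> snd A x" if "x \<in> X" for x
    using h that by (simp_all add: Stone_cat_simps PiE_iff)
  \<comment> \<open>A lower bound of two stages: one whose fibre through \<open>x\<close> lies in
    the open fibre of \<open>h\<close>, one at which the label of \<open>x\<close> is
    attained.\<close>
  have "\<exists>j\<in>J. (\<forall>y\<in>X. \<pi> j y = \<pi> j x \<longrightarrow> h y = h x) \<and> snd C (h x) \<subseteq> lab j (\<pi> j x)" if x: "x \<in> X" for x
  proof -
    have "openin (fst A) {y \<in> X. h y \<in> {h x}}"
    proof (rule openin_continuous_map_preimage)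
      show "continuous_map (fst A) (fst C) h"
        using h by (simp add: Stone_cat_simps)
      show "openin (fst C) {h x}"
        by (subst C_discrete) (simp add: h' x)
    qed
    then obtain i where i: "i \<in> J" "\<And>y. \<lbrakk>y \<in> X; \<pi> i y = \<pi> i x\<rbrakk> \<Longrightarrow> h y = h x"
      using ex_fibre[of "{y \<in> X. h y \<in> {h x}}" x] x by auto
    obtain i' where i': "i' \<in> J" "snd A x \<subseteq> lab i' (\<pi> i' x)"
      using ex_lab[OF x] by blast
    obtain j u u' where j: "j \<in> J" "u \<in> arr j i" "u' \<in> arr j i'"
      using lower_bound[OF i(1) i'(1)] .
    have "h y = h x" if "y \<in> X" "\<pi> j y = \<pi> j x" for y
      using i that x pro_arr_\<pi>[OF j(1) i(1) j(2)] by metis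
    moreover have "snd C (h x) \<subseteq> lab j (\<pi> j x)"
      using h'(2)[OF x] i'(2) lab_pro_arr[OF j(1) i'(1) j(3) \<pi>_pt[OF j(1) x]]
      by (simp add: pro_arr_\<pi>[OF j(1) i'(1) j(3) x])
    ultimately show ?thesis
      using j(1) by blast
  qed
  then obtain i where i: "\<And>x. x \<in> X \<Longrightarrow> i x \<in> J"
    "\<And>x y. \<lbrakk>x \<in> X; y \<in> X; \<pi> (i x) y = \<pi> (i x) x\<rbrakk> \<Longrightarrow> h y = h x"
    "\<And>x. x \<in> X \<Longrightarrow> snd C (h x) \<subseteq> lab (i x) (\<pi> (i x) x)"
    by metis
  define V where "V x = {y \<in> X. \<pi> (i x) y = \<pi> (i x) x}" for x
  have "\<And>U. U \<in> V ` X \<Longrightarrow> openin (fst A) U" "X \<subseteq> \<Union>(V ` X)"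
    using open_fibre i(1) by (auto simp: V_def)
  then obtain \<F> where "finite \<F>" "\<F> \<subseteq> V ` X" "X \<subseteq> \<Union>\<F>"
    using compact unfolding compact_space_alt by meson
  then obtain F where F: "finite F" "F \<subseteq> X" "X \<subseteq> \<Union>(V ` F)"
    by (metis finite_subset_image)
  have "\<exists>k\<in>J. \<exists>c. \<forall>l\<in>i ` F. c l \<in> arr k l"
    using F(1,2) i(1) by (intro finite_lower_bound) auto
  then obtain j c where j: "j \<in> J" and "\<forall>l\<in>i ` F. c l \<in> arr j l"
    by blast
  then have c: "c (i x) \<in> arr j (i x)" if "x \<in> F" for x
    using that by blast
  have near: "\<exists>x\<in>F. \<pi> (i x) y = \<pi> (i x) x" if "y \<in> X" for y
    using F(3) that by (auto simp: V_def)
  have h_cong: "h y = h z" if yz: "y \<in> X" "z \<in> X" "\<pi> j y = \<pi> j z" for y z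
  proof -
    obtain x where x: "x \<in> F" "x \<in> X" "\<pi> (i x) y = \<pi> (i x) x"
      using near[OF yz(1)] F(2) by blast
    then have "\<pi> (i x) z = \<pi> (i x) x"
      using pro_arr_\<pi>[OF j i(1) c, of x] yz by metis
    then show ?thesis
      using i(2)[of x] x yz by metis
  qed
  have lab_h: "snd C (h y) \<subseteq> lab j (\<pi> j y)" if y: "y \<in> X" for y
  proof -
    obtain x where x: "x \<in> F" "x \<in> X" "\<pi> (i x) y = \<pi> (i x) x"
      using near[OF y] F(2) by blast
    have "snd C (h y) \<subseteq> lab (i x) (\<pi> (i x) y)"
      using i(2)[OF x(2) y x(3)] i(3)[OF x(2)] x(3) by simp
    also have "\<dots> \<subseteq> lab j (\<pi> j y)"
      using lab_pro_arr[OF j i(1)[OF x(2)] c[OF x(1)] \<pi>_pt[OF j y]]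
      by (simp add: pro_arr_\<pi>[OF j i(1)[OF x(2)] c[OF x(1)] y])
    finally show ?thesis .
  qed
  obtain k u where k: "k \<in> J" "u \<in> arr k j" "pro_arr P k j u ` pt k \<subseteq> \<pi> j ` X"
    using ex_arr_into_image[OF j] by blast
  then have "\<forall>p\<in>pt k. \<exists>y\<in>X. \<pi> j y = pro_arr P k j u p"
    by fastforce
  then obtain g where g: "\<And>p. p \<in> pt k \<Longrightarrow> g p \<in> X" "\<And>p. p \<in> pt k \<Longrightarrow> \<pi> j (g p) = pro_arr P k j u p"
    by metis
  \<comment> \<open>\<open>g p\<close> is any point of \<open>X\<close> over the image of
    \<open>p\<close> in \<open>pt j\<close>. By \<open>h_cong\<close> the value does not depend on
    this choice, and continuity is automatic on a discrete space.\<close>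
  define f where "f = (\<lambda>p\<in>pt k. h (g p))"
  have "snd C (f p) \<subseteq> lab k p" if "p \<in> pt k" for p
    using lab_h[OF g(1)[OF that]] lab_pro_arr[OF k(1) j k(2) that] that by (simp add: f_def g)
  moreover have "continuous_map (fst (pro_ob P k)) (fst C) f"
    using g h' by (subst discrete[OF k(1)]) (auto simp: f_def)
  ultimately have "f \<in> Hom (Stone_cat L) (pro_ob P k) C"
    using g h' by (auto simp: Stone_cat_simps f_def)
  moreover have "compose X f (\<pi> k) = h"
  proof (rule extensionalityI[of _ X])
    show "h \<in> extensional X"
      using h by (auto simp: Stone_cat_simps PiE_iff)
    fix y assume y: "y \<in> X"
    have "\<pi> j (g (\<pi> k y)) = \<pi> j y"
      by (simp add: g \<pi>_pt k y pro_arr_\<pi>[OF k(1) j k(2) y])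
    then have "h (g (\<pi> k y)) = h y"
      using y k(1) by (intro h_cong g \<pi>_pt)
    then show "compose X f (\<pi> k) y = h y"
      using y k(1) by (simp add: compose_eq f_def \<pi>_pt)
  qed simp
  ultimately show ?thesis
    using k(1) by (auto simp: germs_iff)
qed

text \<open>The hypothesis gives agreement only on points that come from \<open>X\<close>. Below a
  lower bound \<open>k\<close> there is a stage \<open>l\<close> all of whose points are sent into
  the image of \<open>\<pi> k\<close>, and there the two germs agree.\<close>

lemma germs_eq:
  assumes "(j, f) \<in> germs (Stone_cat L) P C" "(j', f') \<in> germs (Stone_cat L) P C"
    and eq: "compose X f (\<pi> j) = compose X f' (\<pi> j')"
  shows "((j, f), (j', f')) \<in> germ_rel (Stone_cat L) P C"
proof -
  have j: "j \<in> J" "j' \<in> J"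
    using assms by (auto simp: germs_iff)
  obtain k u u' where k: "k \<in> J" "u \<in> arr k j" "u' \<in> arr k j'"
    using lower_bound[OF j] .
  obtain l w where l: "l \<in> J" "w \<in> arr l k" "pro_arr P l k w ` pt l \<subseteq> \<pi> k ` X"
    using ex_arr_into_image[OF k(1)] by blast
  have "f (pro_arr P l j (Comp I l k j u w) p) = f' (pro_arr P l j' (Comp I l k j' u' w) p)"
    if p: "p \<in> pt l" for p
  proof -
    obtain y where y: "y \<in> X" "pro_arr P l k w p = \<pi> k y"
      using l(3) p by blast
    have "f (\<pi> j y) = f' (\<pi> j' y)"
      using eq y(1) by (metis compose_eq)
    then show ?thesis
      using j k l p y by (simp add: pro_arr_Comp pro_arr_\<pi>)
  qed
  then have "compose (pt l) f (pro_arr P l j (Comp I l k j u w))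
      = compose (pt l) f' (pro_arr P l j' (Comp I l k j' u' w))"
    by (auto simp: compose_def)
  moreover have "Comp I l k j u w \<in> arr l j" "Comp I l k j' u' w \<in> arr l j'"
    using j k l by (auto intro!: cat_Comp[OF is_category_index])
  ultimately show ?thesis
    using assms(1,2) l(1) unfolding germ_rel_def by (auto simp: Stone_cat_simps(4))
qed

lemma copresents: "C \<in> Obj (FinSet_cat L) \<Longrightarrow> copresents (Stone_cat L) P A \<pi> C"
  unfolding copresents_def using ex_germ[of C] germs_eq[of _ _ C] by (auto simp: Stone_cat_simps(4))

end

section \<open>Cardinalities\<close>

lemma finite_ordLess_Cinfinite: "finite A \<Longrightarrow> Cinfinite \<kappa> \<Longrightarrow> |A| <o \<kappa>"
  by (rule Cfinite_ordLess_Cinfinite) (simp_all add: cfinite_def card_of_card_order_on Field_card_of)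

lemma finite_ordLeq_infinite:
  assumes "finite A" "infinite B"
  shows "|A| \<le>o |B|"
proof -
  have "|A| <o |B|"
    by (rule finite_ordLess_infinite)
      (simp_all add: card_of_well_order_on Field_card_of assms)
  then show ?thesis
    by (rule ordLess_imp_ordLeq)
qed

lemma Times_ordLess_Cinfinite:
  assumes "|A| <o \<kappa>" "Cinfinite \<kappa>"
  shows "|A \<times> A| <o \<kappa>"
proof (cases "finite A")
  case False
  then show ?thesis
    using card_of_Times_same_infinite assms(1) ordIso_ordLess_trans by blast
qed (simp add: finite_ordLess_Cinfinite assms)

text \<open>For infinite \<open>A\<close>, subsets with n + 1 elements arise by inserting a point
  into one with n, so by induction each size contributes at most |A| sets, and there are countably
  many sizes. The full power set could exceed \<kappa>, which need not be a strong limit.\<close>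

lemma Fpow_ordLess_Cinfinite:
  assumes "|A| <o \<kappa>" "Cinfinite \<kappa>"
  shows "|Fpow A| <o \<kappa>"
proof (cases "finite A")
  case True
  then have "finite (Fpow A)"
    by (simp add: Fpow_Pow_finite)
  then show ?thesis
    using assms(2) by (rule finite_ordLess_Cinfinite)
next
  case False
  have "|{S. S \<subseteq> A \<and> finite S \<and> card S = n}| \<le>o |A|" for n
  proof (induction n)
    case 0
    have "{S. S \<subseteq> A \<and> finite S \<and> card S = 0} = {{}}"
      by auto
    then show ?case
      by (simp add: finite_ordLeq_infinite False)
  next
    case (Suc n)
    let ?S = "\<lambda>n. {S. S \<subseteq> A \<and> finite S \<and> card S = n}"
    have "?S (Suc n) \<subseteq> (\<lambda>(S, a). insert a S) ` (?S n \<times> A)"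
    proof
      fix S assume "S \<in> ?S (Suc n)"
      then obtain a T where "S = insert a T" "a \<notin> T" "card T = n" "S \<subseteq> A" "finite T"
        by (auto simp: card_Suc_eq_finite)
      then show "S \<in> (\<lambda>(S, a). insert a S) ` (?S n \<times> A)"
        by (intro image_eqI[of _ _ "(T, a)"]) auto
    qed
    then have "|?S (Suc n)| \<le>o |?S n \<times> A|"
      by (rule surj_imp_ordLeq)
    also have "|?S n \<times> A| \<le>o |A|"
      using Suc.IH False by (intro card_of_Sigma_ordLeq_infinite ballI card_of_mono1 subset_refl)
    finally show ?case .
  qed
  then have "|\<Union>n. {S. S \<subseteq> A \<and> finite S \<and> card S = n}| \<le>o |A|"
    using False infinite_iff_card_of_nat[of A] by (intro card_of_UNION_ordLeq_infinite ballI) blast+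
  moreover have "Fpow A = (\<Union>n. {S. S \<subseteq> A \<and> finite S \<and> card S = n})"
    by (auto simp: Fpow_def)
  ultimately show ?thesis
    using assms(1) ordLeq_ordLess_trans by metis
qed

lemma Sigma_finite_ordLess_Cinfinite:
  assumes "|A| <o \<kappa>" "Cinfinite \<kappa>" "\<And>a. a \<in> A \<Longrightarrow> finite (B a)"
  shows "|SIGMA a:A. B a| <o \<kappa>"
proof (cases "finite A")
  case True
  then show ?thesis
    using assms by (intro finite_ordLess_Cinfinite) auto
next
  case False
  have "|B a| \<le>o |A|" if "a \<in> A" for a
    using assms(3)[OF that] False by (rule finite_ordLeq_infinite)
  then have "|SIGMA a:A. B a| \<le>o |A|"
    using False by (intro card_of_Sigma_ordLeq_infinite ballI card_of_mono1 subset_refl)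
  then show ?thesis
    using assms(1) by (rule ordLeq_ordLess_trans)
qed

lemma ordLess_ex_inj:
  fixes \<kappa> :: "'i rel" and A :: "'b set"
  assumes "|A| <o \<kappa>" "Card_order \<kappa>"
  shows "\<exists>g :: 'b \<Rightarrow> 'i. inj_on g A"
proof -
  have "|A| \<le>o |Field \<kappa>|"
    using assms card_of_Field_ordIso ordIso_symmetric ordLess_imp_ordLeq ordLeq_ordIso_trans by blast
  then show ?thesis
    unfolding card_of_ordLeq[symmetric] by blast
qed

text \<open>\<open>enough_points\<close> speaks of subsets of \<open>'i\<close> only; a set of any
  type with fewer than \<kappa> elements is first injected into \<open>'i\<close>, and its subsets
  are carried along.\<close>

lemma enough_points_ex_inj:
  fixes \<kappa> :: "'i rel" and A :: "'b set"
  assumes "|A| <o \<kappa>" "Card_order \<kappa>" "enough_points \<kappa> TYPE('p)"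
  shows "\<exists>g :: 'b set \<Rightarrow> 'p. inj_on g (Pow A)"
proof -
  obtain g :: "'b \<Rightarrow> 'i" where g: "inj_on g A"
    using ordLess_ex_inj[OF assms(1,2)] by blast
  have "|g ` A| <o \<kappa>"
    using card_of_image assms(1) by (rule ordLeq_ordLess_trans)
  then have "|Pow (g ` A)| \<le>o |UNIV :: 'p set|"
    using assms(3) by (simp add: enough_points_def)
  then obtain h :: "'i set \<Rightarrow> 'p" where h: "inj_on h (Pow (g ` A))"
    unfolding card_of_ordLeq[symmetric] by blast
  have "inj_on (h \<circ> image g) (Pow A)"
    by (intro comp_inj_on inj_on_image_Pow g) (simp add: h image_Pow_surj)
  then show ?thesis
    by blast
qed

section \<open>Existence of limits\<close>

context finset_pro
begin

lemma J_nonempty: "J \<noteq> {}"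
  using cofiltered by (simp add: cofiltered_def)

lemma Obj_index_ordLess:
  assumes "small_category \<kappa> (index P)"
  shows "|J| <o \<kappa>"
proof -
  have "J \<subseteq> fst ` {(a, b, f). a \<in> J \<and> b \<in> J \<and> f \<in> arr a b}"
  proof
    fix j assume "j \<in> J"
    then show "j \<in> fst ` {(a, b, f). a \<in> J \<and> b \<in> J \<and> f \<in> arr a b}"
      using cat_Id[OF is_category_index] by (intro image_eqI[of _ _ "(j, j, Id I j)"]) auto
  qed
  then have "|J| \<le>o |{(a, b, f). a \<in> J \<and> b \<in> J \<and> f \<in> arr a b}|"
    by (rule surj_imp_ordLeq)
  then show ?thesis
    using assms unfolding small_category_def by (rule ordLeq_ordLess_trans)
qed

lemma points_ordLess:
  assumes "small_category \<kappa> (index P)" "Cinfinite \<kappa>"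
  shows "|SIGMA j:J. pt j| <o \<kappa>"
  using assms Obj_index_ordLess by (intro Sigma_finite_ordLess_Cinfinite finite_pt) auto

text \<open>A thread is recovered from its graph, which is a subset of the disjoint union of the
  finite spaces. That union has fewer than \<kappa> elements, although there may be many more
  threads.\<close>

lemma threads_ex_inj:
  assumes "small_category \<kappa> (index P)" "Cinfinite \<kappa>" "enough_points \<kappa> TYPE('p)"
  shows "\<exists>e :: ('i \<Rightarrow> 'p) \<Rightarrow> 'p. inj_on e {x \<in> extensional J. thread P x}"
proof -
  obtain g :: "('i \<times> 'p) set \<Rightarrow> 'p" where g: "inj_on g (Pow (SIGMA j:J. pt j))"
    using enough_points_ex_inj[OF points_ordLess] assms by blast
  define graph where "graph x = (\<lambda>j. (j, x j)) ` J" for x :: "'i \<Rightarrow> 'p"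
  have "inj_on graph {x \<in> extensional J. thread P x}"
  proof (rule inj_onI)
    fix x y assume xy: "x \<in> {x \<in> extensional J. thread P x}" "y \<in> {x \<in> extensional J. thread P x}"
      and eq: "graph x = graph y"
    have "x j = y j" if "j \<in> J" for j
    proof -
      have "(j, x j) \<in> graph y"
        unfolding eq[symmetric] using that by (simp add: graph_def)
      then show ?thesis
        by (auto simp: graph_def)
    qed
    then show "x = y"
      using xy by (auto intro: extensionalityI)
  qed
  moreover have "graph ` {x \<in> extensional J. thread P x} \<subseteq> Pow (SIGMA j:J. pt j)"
    by (auto simp: graph_def thread_def)
  ultimately have "inj_on (g \<circ> graph) {x \<in> extensional J. thread P x}"
    by (intro comp_inj_on inj_on_subset[OF g])
  then show ?thesis
    by blast
qed

lemma compactin_threads: "compactin prod_space {x \<in> extensional J. thread P x}"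
proof -
  have "closedin prod_space (\<Inter>(insert (topspace prod_space) (compat_set ` arrows)))"
    using closedin_compat_set by (intro closedin_Inter) auto
  moreover have "\<Inter>(insert (topspace prod_space) (compat_set ` arrows)) = {x \<in> extensional J. thread P x}"
    using thread_iff by auto
  ultimately show ?thesis
    by (metis closedin_compact_space compact_prod_space)
qed

lemma thread_pt: "\<lbrakk>thread P x; j \<in> J\<rbrakk> \<Longrightarrow> x j \<in> pt j"
  and thread_arr: "\<lbrakk>thread P x; j \<in> J; k \<in> J; u \<in> arr j k\<rbrakk> \<Longrightarrow> pro_arr P j k u (x j) = x k"
  by (simp_all add: thread_def)

text \<open>Labels grow along arrows towards lower stages, so those on a thread are directed; in a
  finite algebra one of maximal cardinality contains all others.\<close>

lemma max_lab:
  fixes x :: "'i \<Rightarrow> 'p"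
  assumes "finite (UNIV :: 'a set)" and x: "thread P x"
  shows "\<exists>j\<in>J. \<forall>i\<in>J. lab i (x i) \<subseteq> lab j (x j)"
proof -
  obtain j0 where "j0 \<in> J"
    using J_nonempty by blast
  moreover have "\<forall>j. j \<in> J \<longrightarrow> card (lab j (x j)) < Suc (card (UNIV :: 'a set))"
    using assms(1) by (auto intro!: le_imp_less_Suc card_mono)
  ultimately have "\<exists>j. j \<in> J \<and> (\<forall>i. i \<in> J \<longrightarrow> card (lab i (x i)) \<le> card (lab j (x j)))"
    by (rule Lattices_Big.ex_has_greatest_nat)
  then obtain j where j: "j \<in> J" "\<forall>i. i \<in> J \<longrightarrow> card (lab i (x i)) \<le> card (lab j (x j))"
    by (elim exE conjE)
  have "lab i (x i) \<subseteq> lab j (x j)" if i: "i \<in> J" for i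
  proof -
    obtain k u v where k: "k \<in> J" "u \<in> arr k i" "v \<in> arr k j"
      using lower_bound[OF i j(1)] .
    have xk: "x k \<in> pt k" "pro_arr P k i u (x k) = x i" "pro_arr P k j v (x k) = x j"
      by (rule thread_pt[OF x k(1)], rule thread_arr[OF x k(1) i k(2)], rule thread_arr[OF x k(1) j(1) k(3)])
    have "lab i (x i) \<subseteq> lab k (x k)" "lab j (x j) \<subseteq> lab k (x k)"
      using lab_pro_arr[OF k(1) i k(2) xk(1)] lab_pro_arr[OF k(1) j(1) k(3) xk(1)]
      unfolding xk(2,3) by this
    moreover have "finite (lab k (x k))"
      using assms(1) by (rule finite_subset[OF subset_UNIV])
    ultimately show ?thesis
      using j(2)[rule_format, OF k(1)] card_seteq by blast
  qed
  with j(1) show ?thesis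
    by blast
qed

text \<open>The space of threads is moved to the type \<open>'p\<close> along \<open>e\<close>, with
  the topology pulled back along the inverse \<open>f\<close>, so that \<open>f\<close> embeds it
  into the product.\<close>

lemma ex_thread_cone:
  fixes e :: "('i \<Rightarrow> 'p) \<Rightarrow> 'p"
  assumes fin: "finite (UNIV :: 'a set)" and e: "inj_on e {x \<in> extensional J. thread P x}"
  shows "\<exists>A \<pi>. thread_cone L P A \<pi>"
proof -
  define Lim where "Lim = {x \<in> extensional J. thread P x}"
  define X where "X = e ` Lim"
  define f where "f = inv_into Lim e"
  define T where "T = pullback_topology X f prod_space"
  define \<pi> where "\<pi> j = (\<lambda>y\<in>X. f y j)" for j
  \<comment> \<open>Every label on the thread must be contained in the new one, and the union is the
    least such set. By \<open>max_lab\<close> it is itself one of the labels, hence a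
    subalgebra.\<close>
  define v where "v = (\<lambda>y\<in>X. \<Union>j\<in>J. lab j (\<pi> j y))"
  have fe: "f (e x) = x" if "x \<in> Lim" for x
    using e that by (simp add: f_def Lim_def)
  have f: "f y \<in> Lim" "e (f y) = y" if "y \<in> X" for y
    using that by (auto simp: X_def fe)
  have thread_f: "thread P (f y)" if "y \<in> X" for y
    using f(1)[OF that] by (simp add: Lim_def)
  have Lim_sub: "Lim \<subseteq> topspace prod_space"
    using compactin_threads by (simp add: Lim_def compactin_def)
  have top[simp]: "topspace T = X"
    using f Lim_sub by (auto simp: T_def topspace_pullback_topology)
  have \<pi>_pt: "\<pi> j y \<in> pt j" if "j \<in> J" "y \<in> X" for j y
    using thread_f[OF that(2)] that by (simp add: \<pi>_def thread_def)
  have \<pi>_compat: "pro_arr P j k u (\<pi> j y) = \<pi> k y" if "j \<in> J" "k \<in> J" "u \<in> arr j k" "y \<in> X" for j k u y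
    using thread_f[OF that(4)] that by (simp add: \<pi>_def thread_def)
  have \<pi>_cont: "continuous_map T (fst (pro_ob P j)) (\<pi> j)" if "j \<in> J" for j
  proof (rule continuous_map_eq)
    show "continuous_map T (fst (pro_ob P j)) ((\<lambda>x. x j) \<circ> f)"
      unfolding T_def by (rule continuous_map_pullback[OF prod_space_proj[OF that]])
  qed (simp add: \<pi>_def)
  have fibre: "{z \<in> X. \<pi> j z \<in> Q} = {z \<in> topspace T. \<pi> j z \<in> Q}" for j Q
    by simp
  have clopen: "openin T {z \<in> X. \<pi> j z \<in> Q}" "closedin T {z \<in> X. \<pi> j z \<in> Q}"
    if "j \<in> J" "Q \<subseteq> pt j" for j Q
  proof -
    have "openin (fst (pro_ob P j)) Q" "closedin (fst (pro_ob P j)) Q"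
      using that(2) by (subst discrete[OF that(1)], simp)+
    then show "openin T {z \<in> X. \<pi> j z \<in> Q}" "closedin T {z \<in> X. \<pi> j z \<in> Q}"
      unfolding fibre
      using openin_continuous_map_preimage[OF \<pi>_cont[OF that(1)]]
          closedin_continuous_map_preimage[OF \<pi>_cont[OF that(1)]] by blast+
  qed
  have nbhd: "\<exists>j\<in>J. {z \<in> X. \<pi> j z \<in> {\<pi> j y}} \<subseteq> U" if U: "openin T U" "y \<in> U" for U y
  proof -
    obtain W where W: "openin prod_space W" "U = f -` W \<inter> X"
      using U(1) unfolding T_def openin_pullback_topology by (elim exE conjE)
    then have y: "f y \<in> W" "y \<in> X"
      using U(2) by auto
    have "\<exists>V. finite {i \<in> J. V i \<noteq> pt i} \<and> (\<forall>i\<in>J. openin (fst (pro_ob P i)) (V i)) \<and>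
        f y \<in> Pi\<^sub>E J V \<and> Pi\<^sub>E J V \<subseteq> W"
      using W(1) y(1) unfolding prod_space_def openin_product_topology_alt by (rule bspec)
    then obtain V where V: "finite {i \<in> J. V i \<noteq> pt i}" "f y \<in> Pi\<^sub>E J V" "Pi\<^sub>E J V \<subseteq> W"
      by (elim exE conjE)
    \<comment> \<open>A basic open set of the product restricts only the coordinates in
      \<open>F\<close>; one stage \<open>k\<close> below all of them controls the whole set.\<close>
    define F where "F = {i \<in> J. V i \<noteq> pt i}"
    obtain k c where k: "k \<in> J" "\<And>i. i \<in> F \<Longrightarrow> c i \<in> arr k i"
      using finite_lower_bound[of F] V(1) by (auto simp: F_def)
    have "z \<in> U" if z: "z \<in> X" "\<pi> k z = \<pi> k y" for z
    proof -
      have "f z i \<in> V i" if i: "i \<in> J" for i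
      proof (cases "i \<in> F")
        case True
        then have "\<pi> i z = \<pi> i y"
          using \<pi>_compat[OF k(1) i k(2)[OF True]] y(2) z by metis
        then show ?thesis
          using V(2) y(2) z(1) i by (auto simp: \<pi>_def)
      next
        case False
        then show ?thesis
          using i \<pi>_pt[OF i z(1)] z(1) by (auto simp: F_def \<pi>_def)
      qed
      moreover have "f z \<in> extensional J"
        using f(1)[OF z(1)] by (simp add: Lim_def)
      ultimately have "f z \<in> Pi\<^sub>E J V"
        by (auto simp: PiE_iff)
      then show ?thesis
        using V(3) W(2) z(1) by auto
    qed
    then show ?thesis
      using k(1) by auto
  qed
  have uniq: "x = y" if "x \<in> X" "y \<in> X" "\<And>j. j \<in> J \<Longrightarrow> \<pi> j x = \<pi> j y" for x y
  proof -
    have "f x = f y"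
      using f(1)[OF that(1)] f(1)[OF that(2)] that
      by (intro extensionalityI[of _ J]) (auto simp: Lim_def \<pi>_def)
    then show ?thesis
      using f(2) that by metis
  qed
  \<comment> \<open>The image under \<open>e\<close> of the set of threads, which is closed in a
    compact product.\<close>
  have "compact_space T"
  proof -
    have "continuous_map (subtopology prod_space Lim) T e"
      unfolding T_def
    proof (rule continuous_map_pullback')
      show "continuous_map (subtopology prod_space Lim) prod_space (f \<circ> e)"
        by (rule continuous_map_eq[OF continuous_map_from_subtopology[OF continuous_map_id]]) (simp add: fe)
    qed (auto simp: X_def)
    moreover have "compactin (subtopology prod_space Lim) Lim"
      using compactin_threads by (simp add: compactin_subtopology Lim_def)
    ultimately have "compactin T (e ` Lim)"
      by (metis image_compactin)
    then show ?thesis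
      by (simp add: compact_space_def X_def)
  qed
  moreover have "Hausdorff_space T"
    unfolding Hausdorff_space_def
  proof (intro allI impI)
    fix x y assume xy: "x \<in> topspace T \<and> y \<in> topspace T \<and> x \<noteq> y"
    then obtain j where j: "j \<in> J" "\<pi> j x \<noteq> \<pi> j y"
      using uniq by auto
    have "openin T {z \<in> X. \<pi> j z \<in> {\<pi> j x}}" "openin T {z \<in> X. \<pi> j z \<in> {\<pi> j y}}"
      using xy by (intro clopen(1)[OF j(1)], simp add: \<pi>_pt[OF j(1)])+
    with j(2) xy show "\<exists>U V. openin T U \<and> openin T V \<and> x \<in> U \<and> y \<in> V \<and> disjnt U V"
      by (intro exI[of _ "{z \<in> X. \<pi> j z \<in> {\<pi> j x}}"] exI[of _ "{z \<in> X. \<pi> j z \<in> {\<pi> j y}}"])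
        (auto simp: disjnt_def)
  qed
  moreover have "neighbourhood_base_of (\<lambda>U. closedin T U \<and> openin T U) T"
    unfolding neighbourhood_base_of
  proof (intro allI impI)
    fix W x assume Wx: "openin T W \<and> x \<in> W"
    then have x: "x \<in> X"
      using openin_subset by fastforce
    obtain j where j: "j \<in> J" "{z \<in> X. \<pi> j z \<in> {\<pi> j x}} \<subseteq> W"
      using nbhd Wx by blast
    then show "\<exists>U V. openin T U \<and> (closedin T V \<and> openin T V) \<and> x \<in> U \<and> U \<subseteq> V \<and> V \<subseteq> W"
      using clopen[of j "{\<pi> j x}"] \<pi>_pt[OF j(1) x] x
      by (intro exI[of _ "{z \<in> X. \<pi> j z \<in> {\<pi> j x}}"]) auto
  qed
  ultimately have stone: "stone_space T"
    by (simp add: stone_space_def)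
  have v_max: "\<exists>j\<in>J. v y = lab j (\<pi> j y)" if y: "y \<in> X" for y
  proof -
    obtain j where "j \<in> J" "\<forall>i\<in>J. lab i (f y i) \<subseteq> lab j (f y j)"
      using max_lab[OF fin thread_f[OF y]] by blast
    then show ?thesis
      using y by (intro bexI[of _ j]) (auto simp: v_def \<pi>_def)
  qed
  \<comment> \<open>A union lies in \<open>S\<close> iff each label on the thread does, and each of
    these is a clopen condition on one coordinate.\<close>
  have closed: "closedin T {x \<in> X. v x \<subseteq> S}" for S
  proof -
    have "closedin T (\<Inter>j\<in>J. {z \<in> X. \<pi> j z \<in> {p \<in> pt j. lab j p \<subseteq> S}})"
      by (intro closedin_INT J_nonempty clopen(2)) auto
    moreover have "{x \<in> X. v x \<subseteq> S} = (\<Inter>j\<in>J. {z \<in> X. \<pi> j z \<in> {p \<in> pt j. lab j p \<subseteq> S}})"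
      using J_nonempty \<pi>_pt by (auto simp: v_def)
    ultimately show ?thesis
      by simp
  qed
  have "v y \<in> {S. subalgebra L S}" if y: "y \<in> X" for y
    using v_max[OF y] subalgebra_lab \<pi>_pt[OF _ y] by auto
  then have "is_stone_object L (T, v)"
    using stone closed by (auto simp: is_stone_object_def v_def)
  moreover have "\<pi> j \<in> Hom (Stone_cat L) (T, v) (pro_ob P j)" if j: "j \<in> J" for j
    using \<pi>_cont[OF j] \<pi>_pt[OF j] j by (auto simp: Stone_cat_simps v_def \<pi>_def)
  moreover have "compose X (pro_arr P j k u) (\<pi> j) = \<pi> k" if "j \<in> J" "k \<in> J" "u \<in> arr j k" for j k u
    using \<pi>_compat[OF that] by (intro extensionalityI[of _ X]) (auto simp: compose_eq \<pi>_def)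
  ultimately have "is_cone (Stone_cat L) P (T, v) \<pi>"
    by (simp add: is_cone_def Stone_cat_simps(1,4))
  moreover have "\<exists>y\<in>X. \<forall>j\<in>J. \<pi> j y = x j" if x: "thread P x" for x
  proof -
    \<comment> \<open>The given thread may take any values off \<open>J\<close>, whereas elements of
      \<open>Lim\<close> are extensional.\<close>
    have "thread P (restrict x J)"
      using x by (simp add: thread_def)
    then have "restrict x J \<in> Lim"
      by (simp add: Lim_def)
    then show ?thesis
      by (intro bexI[of _ "e (restrict x J)"]) (auto simp: X_def \<pi>_def fe)
  qed
  moreover have "\<exists>j\<in>J. v y \<subseteq> lab j (\<pi> j y)" if "y \<in> X" for y
    using v_max[OF that] by auto
  ultimately have "thread_cone L P (T, v) \<pi>"
    using nbhd by (simp add: thread_cone_def)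
  then show ?thesis
    by blast
qed

end

context finset_thread_cone
begin

text \<open>The fibres of the projections form a base, and they are indexed by pairs of a stage and
  one of its finitely many points.\<close>

lemma small_space:
  assumes "small_category \<kappa> (index P)" "Cinfinite \<kappa>"
  shows "small_space \<kappa> (fst A)"
proof -
  define \<B> where "\<B> = (\<lambda>(j, p). {y \<in> X. \<pi> j y = p}) ` (SIGMA j:J. pt j)"
  have "|\<B>| <o \<kappa>"
    unfolding \<B>_def using card_of_image points_ordLess[OF assms] by (rule ordLeq_ordLess_trans)
  moreover have "openin (fst A) = arbitrary union_of (\<lambda>U. U \<in> \<B>)"
    unfolding openin_topology_base_unique
  proof (intro conjI allI impI)
    show "openin (fst A) V" if "V \<in> \<B>" for V
      using that open_fibre by (auto simp: \<B>_def)
    fix U x assume Ux: "openin (fst A) U \<and> x \<in> U"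
    then have x: "x \<in> X"
      using openin_subset by blast
    obtain j where j: "j \<in> J" "\<forall>y\<in>X. \<pi> j y = \<pi> j x \<longrightarrow> y \<in> U"
      using ex_fibre Ux by blast
    then have "{y \<in> X. \<pi> j y = \<pi> j x} \<in> \<B>"
      using \<pi>_pt[OF j(1) x] by (auto simp: \<B>_def)
    then show "\<exists>V. V \<in> \<B> \<and> x \<in> V \<and> V \<subseteq> U"
      using j x by blast
  qed
  ultimately show ?thesis
    unfolding small_space_def by blast
qed

end

section \<open>Every Stone space is a limit of finite ones\<close>

lemma subalgebra_Inter:
  assumes "\<And>S. S \<in> \<S> \<Longrightarrow> subalgebra L S"
  shows "subalgebra L (\<Inter>\<S>)"
  unfolding subalgebra_def
proof (intro allI impI InterI)
  fix f xs S assume "length xs = arity L f \<and> set xs \<subseteq> \<Inter>\<S>" "S \<in> \<S>"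
  moreover from this have "set xs \<subseteq> S"
    by blast
  ultimately show "interp L f xs \<in> S"
    using assms[of S] by (simp add: subalgebra_def)
qed

lemma stone_space_finite_discrete: "finite Q \<Longrightarrow> stone_space (discrete_topology Q)"
proof -
  have "neighbourhood_base_of (\<lambda>U. closedin (discrete_topology Q) U \<and> openin (discrete_topology Q) U)
      (discrete_topology Q)"
    unfolding neighbourhood_base_of
  proof (intro allI impI)
    fix W x assume "openin (discrete_topology Q) W \<and> x \<in> W"
    then show "\<exists>U V. openin (discrete_topology Q) U \<and>
        (closedin (discrete_topology Q) V \<and> openin (discrete_topology Q) V) \<and> x \<in> U \<and> U \<subseteq> V \<and> V \<subseteq> W"
      by (intro exI[of _ W]) simp
  qed
  then show "finite Q \<Longrightarrow> stone_space (discrete_topology Q)"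
    by (simp add: stone_space_def compact_space_discrete_topology)
qed

definition clopens :: "'p topology \<Rightarrow> 'p set set" where
  "clopens X = {U. openin X U \<and> closedin X U}"

text \<open>A clopen set is open and compact, hence a union of finitely many members of the
  base.\<close>

lemma clopens_ordLess:
  assumes small: "small_space \<kappa> X" and \<kappa>: "Cinfinite \<kappa>" and X: "compact_space X"
  shows "|clopens X| <o \<kappa>"
proof -
  obtain \<B> where \<B>: "|\<B>| <o \<kappa>" and base: "openin X = arbitrary union_of (\<lambda>U. U \<in> \<B>)"
    using small by (auto simp: small_space_def)
  have "U \<in> \<Union> ` Fpow \<B>" if U: "U \<in> clopens X" for U
  proof -
    have "(arbitrary union_of (\<lambda>U. U \<in> \<B>)) U"
      using U base by (simp add: clopens_def)
    then obtain \<U> where \<U>: "\<U> \<subseteq> \<B>" "\<Union>\<U> = U"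
      by (auto simp: union_of_def arbitrary_def)
    have "openin X B" if "B \<in> \<U>" for B
      using that \<U>(1) unfolding base by (auto intro: arbitrary_union_of_inc)
    moreover have "compactin X U"
      using U X by (simp add: clopens_def closedin_compact_space)
    ultimately obtain \<F> where "finite \<F>" "\<F> \<subseteq> \<U>" "U \<subseteq> \<Union>\<F>"
      using \<U>(2) unfolding compactin_def by (metis subset_refl)
    then show ?thesis
      using \<U> by (intro image_eqI[of _ _ \<F>]) (auto simp: Fpow_def)
  qed
  then have "|clopens X| \<le>o |Fpow \<B>|"
    by (intro surj_imp_ordLeq) blast
  then show ?thesis
    using Fpow_ordLess_Cinfinite[OF \<B> \<kappa>] by (rule ordLeq_ordLess_trans)
qed

locale stone_object =
  fixes L :: "('f, 'a) algebra" and X :: "'p topology" and v :: "'p \<Rightarrow> 'a set"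
  assumes finite_algebra: "finite (UNIV :: 'a set)"
    and stone_object: "is_stone_object L (X, v)"
begin

lemma compact: "compact_space X" and Hausdorff: "Hausdorff_space X"
  and clopen_base: "neighbourhood_base_of (\<lambda>U. closedin X U \<and> openin X U) X"
  and subalgebra_v: "x \<in> topspace X \<Longrightarrow> subalgebra L (v x)"
  and closed_v: "subalgebra L S \<Longrightarrow> closedin X {x \<in> topspace X. v x \<subseteq> S}"
  using stone_object by (auto simp: is_stone_object_def stone_space_def PiE_iff)

lemma ex_clopen:
  assumes "openin X U" "x \<in> U"
  obtains V where "V \<in> clopens X" "x \<in> V" "V \<subseteq> U"
proof -
  have "\<exists>U' V. openin X U' \<and> (closedin X V \<and> openin X V) \<and> x \<in> U' \<and> U' \<subseteq> V \<and> V \<subseteq> U"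
    using clopen_base assms by (simp add: neighbourhood_base_of)
  then show thesis
    using that by (auto simp: clopens_def)
qed

text \<open>Remove from the space the closed sets of points with label inside \<open>S\<close>, for
  all subalgebras \<open>S\<close> not containing \<open>v x\<close>. They are finitely many, so the
  rest is open; a point \<open>y\<close> whose label does not contain \<open>v x\<close> is removed
  by \<open>S = v y\<close>.\<close>

lemma ex_clopen_v:
  assumes x: "x \<in> topspace X"
  obtains V where "V \<in> clopens X" "x \<in> V" "\<And>y. y \<in> V \<Longrightarrow> v x \<subseteq> v y"
proof -
  define W where "W = topspace X - \<Union>{{y \<in> topspace X. v y \<subseteq> S} | S. subalgebra L S \<and> \<not> v x \<subseteq> S}"
  have "finite {S. subalgebra L S \<and> \<not> v x \<subseteq> S}"
    using finite_algebra by (metis Finite_Set.finite_set finite_subset subset_UNIV)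
  then have "closedin X (\<Union>{{y \<in> topspace X. v y \<subseteq> S} | S. subalgebra L S \<and> \<not> v x \<subseteq> S})"
    using closed_v by (intro closedin_Union) auto
  then have "openin X W"
    unfolding W_def by (rule openin_diff[OF openin_topspace])
  moreover have "x \<in> W"
    using x by (auto simp: W_def)
  ultimately obtain V where V: "V \<in> clopens X" "x \<in> V" "V \<subseteq> W"
    using ex_clopen by blast
  moreover have "v x \<subseteq> v y" if "y \<in> V" for y
  proof (rule ccontr)
    assume "\<not> v x \<subseteq> v y"
    moreover have "y \<in> W" "y \<in> topspace X"
      using V(3) that by (auto simp: W_def)
    ultimately show False
      using subalgebra_v[of y] unfolding W_def by blast
  qed
  ultimately show thesis
    using that by blast
qed

section \<open>Quotients by finite sets of clopens\<close>

definition same :: "'p set set \<Rightarrow> 'p \<Rightarrow> 'p \<Rightarrow> bool" where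
  "same F x y \<longleftrightarrow> (\<forall>U\<in>F. x \<in> U \<longleftrightarrow> y \<in> U)"

text \<open>
  The quotient of \<open>X\<close> by \<open>same F\<close> is realised on a set \<open>quot F\<close> of representatives, so that it is
  again carried by the type \<open>'p\<close>.
\<close>

definition rep :: "'p set set \<Rightarrow> 'p \<Rightarrow> 'p" where
  "rep F x = (SOME y. y \<in> topspace X \<and> same F y x)"

definition quot :: "'p set set \<Rightarrow> 'p set" where
  "quot F = rep F ` topspace X"

text \<open>The quotient map is a morphism only if the label of a block lies inside the labels of
  all its points; the intersection is the greatest such choice and is again a subalgebra.\<close>

definition quot_lab :: "'p set set \<Rightarrow> 'p \<Rightarrow> 'a set" where
  "quot_lab F = (\<lambda>p\<in>quot F. \<Inter>{v y | y. y \<in> topspace X \<and> rep F y = p})"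

lemma same_refl: "same F x x"
  by (simp add: same_def)

lemma rep:
  assumes "x \<in> topspace X"
  shows "rep F x \<in> topspace X" "same F (rep F x) x"
proof -
  have "rep F x \<in> topspace X \<and> same F (rep F x) x"
    unfolding rep_def by (rule someI[of _ x]) (simp add: assms same_refl)
  then show "rep F x \<in> topspace X" "same F (rep F x) x"
    by auto
qed

lemma rep_cong: "same F x y \<Longrightarrow> rep F x = rep F y"
  by (simp add: rep_def same_def)

lemma rep_eq_iff:
  assumes "x \<in> topspace X" "y \<in> topspace X"
  shows "rep F x = rep F y \<longleftrightarrow> same F x y"
proof
  assume "rep F x = rep F y"
  then show "same F x y"
    using rep(2)[OF assms(1), of F] rep(2)[OF assms(2), of F] by (simp add: same_def)
qed (rule rep_cong)

lemma rep_rep: "\<lbrakk>x \<in> topspace X; F \<subseteq> G\<rbrakk> \<Longrightarrow> rep F (rep G x) = rep F x"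
  using rep(2)[of x G] by (intro rep_cong) (auto simp: same_def)

lemma quot_topspace: "p \<in> quot F \<Longrightarrow> p \<in> topspace X"
  using rep(1) by (auto simp: quot_def)

lemma rep_quot: "p \<in> quot F \<Longrightarrow> rep F p = p"
  by (auto simp: quot_def rep_rep)

lemma rep_in_quot: "x \<in> topspace X \<Longrightarrow> rep F x \<in> quot F"
  by (simp add: quot_def)

text \<open>A representative is determined by which members of \<open>F\<close> contain it.\<close>

lemma finite_quot:
  assumes "finite F"
  shows "finite (quot F)"
proof (rule finite_imageD)
  show "finite ((\<lambda>p. {U \<in> F. p \<in> U}) ` quot F)"
    by (rule finite_subset[of _ "Pow F"]) (use assms in auto)
  show "inj_on (\<lambda>p. {U \<in> F. p \<in> U}) (quot F)"
  proof (rule inj_onI)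
    fix p q assume pq: "p \<in> quot F" "q \<in> quot F" "{U \<in> F. p \<in> U} = {U \<in> F. q \<in> U}"
    then have "same F p q"
      unfolding same_def by blast
    then show "p = q"
      using rep_cong rep_quot pq(1,2) by metis
  qed
qed

lemma clopen_same:
  assumes "finite F" "F \<subseteq> clopens X"
  shows "{y \<in> topspace X. same F y x} \<in> clopens X"
  using assms
proof (induction F)
  case empty
  then show ?case
    by (simp add: same_def clopens_def)
next
  case (insert U F)
  have "{y \<in> topspace X. same (insert U F) y x}
      = {y \<in> topspace X. same F y x} \<inter> (if x \<in> U then U else topspace X - U)"
    using insert.prems by (auto simp: same_def clopens_def dest: openin_subset)
  then show ?case
    using insert by (auto simp: clopens_def)
qed

lemma quot_lab_rep_le: "x \<in> topspace X \<Longrightarrow> quot_lab F (rep F x) \<subseteq> v x"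
  by (auto simp: quot_lab_def rep_in_quot)

lemma quot_object:
  assumes "finite F"
  shows "(discrete_topology (quot F), quot_lab F) \<in> Obj (FinSet_cat L)"
proof -
  have "subalgebra L (quot_lab F p)" if "p \<in> quot F" for p
    using that subalgebra_v by (auto simp: quot_lab_def intro!: subalgebra_Inter)
  then show ?thesis
    using finite_quot[OF assms]
    by (auto simp: FinSet_cat_simps is_stone_object_def stone_space_finite_discrete quot_lab_def)
qed

lemma rep_Hom:
  assumes F: "finite F" "F \<subseteq> clopens X"
  shows "restrict (rep F) (topspace X) \<in> Hom (Stone_cat L) (X, v) (discrete_topology (quot F), quot_lab F)"
proof -
  have "openin X {x \<in> topspace X. restrict (rep F) (topspace X) x \<in> U}" for U
  proof (subst openin_subopen, safe)
    fix x assume x: "x \<in> topspace X" "restrict (rep F) (topspace X) x \<in> U"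
    have "openin X {y \<in> topspace X. same F y x}"
      using clopen_same[OF F] by (simp add: clopens_def)
    moreover have "{y \<in> topspace X. same F y x} \<subseteq> {x \<in> topspace X. restrict (rep F) (topspace X) x \<in> U}"
      using x rep_cong by fastforce
    ultimately show "\<exists>T. openin X T \<and> x \<in> T \<and> T \<subseteq> {x \<in> topspace X. restrict (rep F) (topspace X) x \<in> U}"
      using x(1) same_refl by blast
  qed
  then show ?thesis
    using rep_in_quot quot_lab_rep_le by (auto simp: Stone_cat_simps continuous_map_def)
qed

text \<open>A block of \<open>F\<close> lies inside a block of the coarser \<open>G\<close>, so its
  label is an intersection over fewer points and hence larger, as a morphism requires.\<close>

lemma rep_quot_Hom:
  assumes "G \<subseteq> F"
  shows "restrict (rep G) (quot F)
    \<in> Hom (Stone_cat L) (discrete_topology (quot F), quot_lab F) (discrete_topology (quot G), quot_lab G)"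
proof -
  have "quot_lab G (rep G p) \<subseteq> quot_lab F p" if p: "p \<in> quot F" for p
  proof -
    have "rep G y = rep G p" if "y \<in> topspace X" "rep F y = p" for y
      using rep_rep[OF that(1) assms] that(2) by simp
    then show ?thesis
      using p rep_in_quot[OF quot_topspace[OF p]] by (auto simp: quot_lab_def)
  qed
  then show ?thesis
    by (auto simp: Stone_cat_simps intro: rep_in_quot quot_topspace)
qed

text \<open>Finite sets of clopens, coded by \<open>c\<close> as elements of \<open>'i\<close> and ordered by reverse inclusion.\<close>

definition quot_pro ::
  "('p set set \<Rightarrow> 'i) \<Rightarrow> ('i, 'p topology \<times> ('p \<Rightarrow> 'a set), 'p \<Rightarrow> 'p) pro_object" where
  "quot_pro c = (let d = inv_into (Fpow (clopens X)) c in
     \<lparr>index = \<lparr>Obj = c ` Fpow (clopens X), Hom = (\<lambda>a b. {u. u = a \<and> d b \<subseteq> d a}),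
        Id = (\<lambda>a. a), Comp = (\<lambda>a b e g f. a)\<rparr>,
      diagram = \<lparr>Fobj = (\<lambda>a. (discrete_topology (quot (d a)), quot_lab (d a))),
        Farr = (\<lambda>a b u. restrict (rep (d b)) (quot (d a)))\<rparr>\<rparr>)"

text \<open>The index is a directed order: an arrow from \<open>a\<close> to \<open>b\<close> is
  coded by \<open>a\<close> itself, and codes of unions provide lower bounds. The transition maps
  replace a representative for the finer partition by one for the coarser partition.\<close>

lemma quot_pro:
  fixes \<kappa> :: "'i rel" and c :: "'p set set \<Rightarrow> 'i"
  assumes \<kappa>: "Cinfinite \<kappa>" and small: "small_space \<kappa> X"
    and c: "inj_on c (Fpow (clopens X))"
  shows "is_pro_object \<kappa> (FinSet_cat L) (quot_pro c)"
    and "\<exists>\<pi>. thread_cone L (quot_pro c) (X, v) \<pi>"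
proof -
  define d where "d = inv_into (Fpow (clopens X)) c"
  define J where "J = c ` Fpow (clopens X)"
  have d: "finite (d a)" "d a \<subseteq> clopens X" if "a \<in> J" for a
    using inv_into_into[of a c "Fpow (clopens X)"] that by (auto simp: J_def d_def Fpow_def)
  have dc: "c F \<in> J" "d (c F) = F" if "finite F" "F \<subseteq> clopens X" for F
    using c that by (auto simp: J_def d_def Fpow_def)
  define P where "P = quot_pro c"
  have P: "Obj (index P) = J" "Hom (index P) a b = {u. u = a \<and> d b \<subseteq> d a}" "Id (index P) a = a"
    "Comp (index P) a b e g f = a"
    "pro_ob P a = (discrete_topology (quot (d a)), quot_lab (d a))"
    "pro_arr P a b u = restrict (rep (d b)) (quot (d a))" for a b e g f u
    by (simp_all add: P_def quot_pro_def J_def d_def Let_def)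
  have index: "is_category (index P)"
    by (auto simp: is_category_def P)
  have "is_functor (index P) (FinSet_cat L) (diagram P)"
  proof (rule is_functorI[OF index is_category_FinSet_cat])
    fix a b f assume "a \<in> Obj (index P)" "b \<in> Obj (index P)" "f \<in> Hom (index P) a b"
    then show "pro_arr P a b f \<in> Hom (FinSet_cat L) (pro_ob P a) (pro_ob P b)"
      by (simp add: P FinSet_cat_simps rep_quot_Hom)
  next
    fix a assume "a \<in> Obj (index P)"
    show "pro_arr P a a (Id (index P) a) = Id (FinSet_cat L) (pro_ob P a)"
      by (auto simp: P FinSet_cat_simps Stone_cat_simps rep_quot)
  next
    fix a b e f g
    assume *: "a \<in> Obj (index P)" "b \<in> Obj (index P)" "e \<in> Obj (index P)"
      "f \<in> Hom (index P) a b" "g \<in> Hom (index P) b e"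
    then show "pro_arr P a e (Comp (index P) a b e g f)
      = Comp (FinSet_cat L) (pro_ob P a) (pro_ob P b) (pro_ob P e) (pro_arr P b e g) (pro_arr P a b f)"
      by (auto simp: P FinSet_cat_simps Stone_cat_simps compose_def rep_in_quot rep_rep quot_topspace)
  qed (simp add: P d quot_object)
  moreover have "cofiltered (index P)"
    unfolding cofiltered_def
  proof (intro conjI ballI)
    show "Obj (index P) \<noteq> {}"
      using dc(1)[of "{}"] by (auto simp: P)
    fix a b assume ab: "a \<in> Obj (index P)" "b \<in> Obj (index P)"
    then have "c (d a \<union> d b) \<in> J" "d (c (d a \<union> d b)) = d a \<union> d b"
      using dc d by (auto simp: P)
    then show "\<exists>e\<in>Obj (index P). Hom (index P) e a \<noteq> {} \<and> Hom (index P) e b \<noteq> {}"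
      by (auto simp: P)
    fix f g assume "f \<in> Hom (index P) a b" "g \<in> Hom (index P) a b"
    then show "\<exists>e\<in>Obj (index P). \<exists>h\<in>Hom (index P) e a.
        Comp (index P) e a b f h = Comp (index P) e a b g h"
      using ab by (auto simp: P)
  qed
  moreover have "small_category \<kappa> (index P)"
  proof -
    have "|J| \<le>o |Fpow (clopens X)|"
      unfolding J_def by (rule card_of_image)
    then have "|J| <o \<kappa>"
      using Fpow_ordLess_Cinfinite[OF clopens_ordLess[OF small \<kappa> compact] \<kappa>] by (rule ordLeq_ordLess_trans)
    then have "|J \<times> J| <o \<kappa>"
      using \<kappa> by (rule Times_ordLess_Cinfinite)
    \<comment> \<open>An arrow is determined by its two ends, so the arrows are at most as many as
      the pairs of objects.\<close>
    moreover have "{(a, b, f). a \<in> J \<and> b \<in> J \<and> f \<in> Hom (index P) a b} \<subseteq> (\<lambda>(a, b). (a, b, a)) ` (J \<times> J)"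
      by (auto simp: P)
    ultimately show ?thesis
      unfolding small_category_def P(1) by (meson surj_imp_ordLeq ordLeq_ordLess_trans)
  qed
  ultimately show "is_pro_object \<kappa> (FinSet_cat L) (quot_pro c)"
    by (simp add: is_pro_object_def P_def)
  define \<pi> where "\<pi> a = restrict (rep (d a)) (topspace X)" for a
  have "is_cone (Stone_cat L) P (X, v) \<pi>"
    unfolding is_cone_def
  proof (intro conjI ballI)
    show "(X, v) \<in> Obj (Stone_cat L)"
      using stone_object by (simp add: Stone_cat_simps)
    show "\<pi> a \<in> Hom (Stone_cat L) (X, v) (pro_ob P a)" if "a \<in> Obj (index P)" for a
      unfolding P \<pi>_def using that by (intro rep_Hom d) (simp_all add: P)
    show "Comp (Stone_cat L) (X, v) (pro_ob P a) (pro_ob P b) (pro_arr P a b u) (\<pi> a) = \<pi> b"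
      if "u \<in> Hom (index P) a b" for a b u
      using that by (auto simp: P Stone_cat_simps \<pi>_def compose_def rep_in_quot rep_rep)
  qed
  moreover have "\<exists>y\<in>topspace X. \<forall>a\<in>J. \<pi> a y = x a" if "thread P x" for x
  proof -
    have x: "x a \<in> quot (d a)" if "a \<in> J" for a
      using \<open>thread P x\<close> that by (simp add: thread_def P)
    have x_compat: "rep (d b) (x a) = x b" if "a \<in> J" "b \<in> J" "d b \<subseteq> d a" for a b
      using \<open>thread P x\<close> that x by (simp add: thread_def P)
    \<comment> \<open>A thread selects one block for each finite set of clopens; a point common to
      all of these closed blocks realises it.\<close>
    have "topspace X \<inter> \<Inter>((\<lambda>a. {y \<in> topspace X. same (d a) y (x a)}) ` J) \<noteq> {}"
    proof (rule compactin_INT_nonempty)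
      show "compactin X (topspace X)"
        using compact by (simp add: compact_space_def)
      show "closedin X {y \<in> topspace X. same (d a) y (x a)}" if "a \<in> J" for a
        using clopen_same[OF d[OF that]] by (simp add: clopens_def)
      fix B assume B: "finite B" "B \<subseteq> J"
      \<comment> \<open>The code of a common refinement of the partitions in \<open>B\<close>:
        compatibility of the thread puts the single point \<open>x a\<close> into all the selected
        blocks.\<close>
      define a where "a = c (\<Union>(d ` B))"
      have a: "a \<in> J" "d a = \<Union>(d ` B)"
        unfolding a_def using B d by (intro dc; blast)+
      have "x a \<in> topspace X"
        using x[OF a(1)] quot_topspace by blast
      moreover have "same (d b) (x a) (x b)" if b: "b \<in> B" for b
      proof -
        have "b \<in> J" "d b \<subseteq> d a"
          using a B b by auto
        then have "rep (d b) (x a) = rep (d b) (x b)"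
          using x_compat[OF a(1)] rep_quot[OF x] by simp
        then show ?thesis
          using rep_eq_iff[of "x a" "x b" "d b"] x[OF a(1)] x[OF \<open>b \<in> J\<close>] quot_topspace by blast
      qed
      ultimately show "topspace X \<inter> \<Inter>((\<lambda>a. {y \<in> topspace X. same (d a) y (x a)}) ` B) \<noteq> {}"
        by blast
    qed
    then obtain y where y: "y \<in> topspace X" "\<And>a. a \<in> J \<Longrightarrow> same (d a) y (x a)"
      by blast
    have "\<pi> a y = x a" if "a \<in> J" for a
      using rep_cong[OF y(2)[OF that]] rep_quot[OF x[OF that]] y(1) by (simp add: \<pi>_def)
    then show ?thesis
      using y(1) by blast
  qed
  moreover have "\<exists>a\<in>J. {z \<in> topspace X. \<pi> a z = \<pi> a y} \<subseteq> U" if U: "openin X U" "y \<in> U" for U y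
  proof -
    obtain V where V: "V \<in> clopens X" "y \<in> V" "V \<subseteq> U"
      using ex_clopen[OF U] .
    \<comment> \<open>The partition by the single clopen \<open>V\<close> is fine enough: the block
      of \<open>y\<close> is \<open>V\<close> itself.\<close>
    have a: "c {V} \<in> J" "d (c {V}) = {V}"
      using dc[of "{V}"] V(1) by auto
    have y: "y \<in> topspace X"
      using U openin_subset by blast
    have "z \<in> V" if "z \<in> topspace X" "rep {V} z = rep {V} y" for z
      using rep_eq_iff[OF that(1) y] that(2) V(2) by (simp add: same_def)
    then have "{z \<in> topspace X. \<pi> (c {V}) z = \<pi> (c {V}) y} \<subseteq> U"
      using V(3) y by (auto simp: \<pi>_def a(2))
    with a(1) show ?thesis
      by blast
  qed
  moreover have "\<exists>a\<in>J. v y \<subseteq> quot_lab (d a) (\<pi> a y)" if y: "y \<in> topspace X" for y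
  proof -
    obtain V where V: "V \<in> clopens X" "y \<in> V" "\<And>z. z \<in> V \<Longrightarrow> v y \<subseteq> v z"
      using ex_clopen_v[OF y] by blast
    have a: "c {V} \<in> J" "d (c {V}) = {V}"
      using dc[of "{V}"] V(1) by auto
    have "v y \<subseteq> v z" if "z \<in> topspace X" "rep {V} z = rep {V} y" for z
      using rep_eq_iff[OF that(1) y] that(2) V(2,3) by (simp add: same_def)
    \<comment> \<open>On the block \<open>V\<close> of \<open>y\<close> every label contains
      \<open>v y\<close>, hence so does their intersection.\<close>
    then have "v y \<subseteq> quot_lab {V} (rep {V} y)"
      by (auto simp: quot_lab_def rep_in_quot y)
    then show ?thesis
      using a y by (intro bexI[of _ "c {V}"]) (simp_all add: \<pi>_def)
  qed
  ultimately have "thread_cone L P (X, v) \<pi>"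
    by (simp add: thread_cone_def P)
  then show "\<exists>\<pi>. thread_cone L (quot_pro c) (X, v) \<pi>"
    unfolding P_def by blast
qed

end

section \<open>The equivalence\<close>

lemma finite_imp_small_space:
  assumes "finite (topspace X)" "Cinfinite \<kappa>"
  shows "small_space \<kappa> X"
proof -
  have "{U. openin X U} \<subseteq> Pow (topspace X)"
    using openin_subset by blast
  then have "finite {U. openin X U}"
    using assms(1) by (meson finite_Pow_iff finite_subset)
  then have "|{U. openin X U}| <o \<kappa>"
    using assms(2) by (rule finite_ordLess_Cinfinite)
  moreover have "openin X = arbitrary union_of (\<lambda>U. U \<in> {U. openin X U})"
    unfolding openin_topology_base_unique by auto
  ultimately show ?thesis
    unfolding small_space_def by blast
qed

text \<open>Finite spaces are \<kappa>-small, so the finite objects form a full subcategory of the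
  small Stone spaces as well; this is the form in which \<open>Pro_equivalent\<close>
  applies.\<close>

lemma FinSet_cat_eq:
  fixes L :: "('f, 'a) algebra"
  assumes "Cinfinite \<kappa>"
  shows "(FinSet_cat L :: ('p topology \<times> ('p \<Rightarrow> 'a set), 'p \<Rightarrow> 'p) category)
    = full_subcategory (Small_Stone_cat \<kappa> L) (\<lambda>(X, v). finite (topspace X))"
proof -
  have "{A \<in> Obj (Stone_cat L). case A of (X :: 'p topology, v) \<Rightarrow> finite (topspace X)}
    = {A \<in> Obj (Stone_cat L). (case A of (X, v) \<Rightarrow> small_space \<kappa> X) \<and> (case A of (X, v) \<Rightarrow> finite (topspace X))}"
    using finite_imp_small_space[OF _ assms] by auto
  then show ?thesis
    by (simp add: FinSet_cat_def Small_Stone_cat_def full_subcategory_def)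
qed

text \<open>Arrows are the same and fewer cones have to be tested, so it suffices that the vertex
  stays in the subcategory.\<close>

lemma limit_cone_full_subcategory:
  assumes "limit_cone D P X \<pi>" "p X"
  shows "limit_cone (full_subcategory D p) P X \<pi>"
  using assms by (simp add: limit_cone_def is_cone_def)

lemma copresents_full_subcategory:
  "copresents (full_subcategory D p) P X \<pi> c \<longleftrightarrow> copresents D P X \<pi> c"
  by (simp add: copresents_def full_subcategory_pro_simps)

theorem theorem3p7:
  fixes L :: "('f, 'a::{finite, bounded_lattice}) algebra"
    and \<kappa> :: "'i rel"
  assumes "lattice_based L"
    and "(bot :: 'a) \<noteq> top"
    and "semi_primal L"
    and "Cinfinite \<kappa>"
    and "enough_points \<kappa> TYPE('p)"
  shows "equivalent_categories
           (Pro \<kappa> (FinSet_cat L :: ('p topology \<times> ('p \<Rightarrow> 'a set), 'p \<Rightarrow> 'p) category))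
           (Small_Stone_cat \<kappa> L :: ('p topology \<times> ('p \<Rightarrow> 'a set), 'p \<Rightarrow> 'p) category)"
  unfolding FinSet_cat_eq[OF assms(4)]
proof (rule Pro_equivalent, unfold FinSet_cat_eq[OF assms(4), symmetric])
  show "is_category (Small_Stone_cat \<kappa> L :: ('p topology \<times> ('p \<Rightarrow> 'a set), 'p \<Rightarrow> 'p) category)"
    by (simp add: Small_Stone_cat_def is_category_full_subcategory is_category_Stone_cat)
next
  note \<kappa> = assms(4)
  fix P :: "('i, 'p topology \<times> ('p \<Rightarrow> 'a set), 'p \<Rightarrow> 'p) pro_object"
  assume P: "is_pro_object \<kappa> (FinSet_cat L) P"
  interpret finset_pro L P
    using P by unfold_locales (simp_all add: is_pro_object_def)
  have small: "small_category \<kappa> (index P)"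
    using P by (simp add: is_pro_object_def)
  \<comment> \<open>Here \<open>enough_points\<close> provides room in \<open>'p\<close> for all
    threads of the diagram.\<close>
  obtain A \<pi> where "thread_cone L P A \<pi>"
    using threads_ex_inj[OF small \<kappa> assms(5)] ex_thread_cone finite by blast
  then interpret finset_thread_cone L P A \<pi>
    by unfold_locales
  show "\<exists>X \<pi>. limit_cone (Small_Stone_cat \<kappa> L) P X \<pi> \<and>
      (\<forall>c\<in>Obj (FinSet_cat L). copresents (Small_Stone_cat \<kappa> L) P X \<pi> c)"
    using limit_cone small_space[OF small \<kappa>] copresents unfolding Small_Stone_cat_def
    by (intro exI[of _ A] exI[of _ \<pi>])
      (auto simp: copresents_full_subcategory split_beta intro!: limit_cone_full_subcategory)
next
  note \<kappa> = assms(4)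
  fix A :: "'p topology \<times> ('p \<Rightarrow> 'a set)"
  assume A: "A \<in> Obj (Small_Stone_cat \<kappa> L)"
  obtain X v where Xv: "A = (X, v)"
    by (cases A)
  have small: "small_space \<kappa> X"
    using A by (simp add: Xv Small_Stone_cat_def)
  interpret stone_object L X v
    using A by unfold_locales (simp_all add: Xv Small_Stone_cat_def Stone_cat_simps)
  \<comment> \<open>This bound lets the finite sets of clopens be named by elements of
    \<open>'i\<close>, as an index category must be.\<close>
  have "|Fpow (clopens X)| <o \<kappa>"
    by (intro Fpow_ordLess_Cinfinite clopens_ordLess small \<kappa> compact)
  then obtain c :: "'p set set \<Rightarrow> 'i" where c: "inj_on c (Fpow (clopens X))"
    using ordLess_ex_inj \<kappa> by blast
  note P = quot_pro[OF \<kappa> small c]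
  obtain \<pi> where "thread_cone L (quot_pro c) (X, v) \<pi>"
    using P(2) by blast
  then interpret finset_thread_cone L "quot_pro c" "(X, v)" \<pi>
    using P(1) by unfold_locales (simp_all add: is_pro_object_def)
  show "\<exists>P \<pi>. is_pro_object \<kappa> (FinSet_cat L) P \<and> limit_cone (Small_Stone_cat \<kappa> L) P A \<pi>"
    using P(1) limit_cone small unfolding Small_Stone_cat_def Xv
    by (intro exI[of _ "quot_pro c"] exI[of _ \<pi>]) (auto intro!: limit_cone_full_subcategory)
qed

end
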